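(* Let $\mathbb{F}$ be a prime field and let $f \in \mathbb{F}[x_1,\ldots,x_n]$ be a cubic polynomial ($\deg(f)=3$) with $\mathrm{bias}(f)=\delta$. Then there exist $c_1 = O(\log(1/\delta))$ quadratic polynomials $q_1,\ldots,q_{c_1} \in \mathbb{F}[x_1,\ldots,x_n]$ and linear functions $\ell_1,\ldots,\ell_{c_1}\in \mathbb{F}[x_1,\ldots,x_n]$, another $c_2 = O(\log^4(1/\delta))$ linear functions $\ell'_1,\ldots,\ell'_{c_2} \in \mathbb{F}[x_1,\ldots,x_n]$, and a cubic polynomial $g$ in $c_2$ variables such that $$f = \sum_{j=1}^{c_1} \ell_j \cdot q_j + g(\ell'_1,\ldots,\ell'_{c_2}).$$
   Context: For $f:\mathbb{F}^n\to\mathbb{F}$, $\mathrm{bias}(f) = \left|\mathbb{E}_{a \in \mathbb{F}^n}[\omega^{f(a)}]\right|$ with $\omega = e^{2\pi i/|\mathbb{F}|}$ (expectation over uniform $a$). Polynomials are identified with the functions $\mathbb{F}^n\to\mathbb{F}$ they define (i.e. one works modulo $x_i^{p}-x_i$, $p=|\mathbb{F}|$), equality means equality as functions, and the degree of a function is the least degree of a polynomial representing it. In the conclusion, "linear", "quadratic", "cubic" mean degree at most $1,2,3$ (linear functions may have a constant term). The implied constants in $O(\cdot)$ may depend on the fixed field $\mathbb{F}$ but not on $n$, $f$ or $\delta$. *)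

theory Defs
  imports
    Complex_Main
    "HOL-Library.FuncSet"
    "HOL-Library.Poly_Mapping"
    "Berlekamp_Zassenhaus.Finite_Field"
begin

text \<open>
  Polynomials in the variables \<open>x\<^sub>0, x\<^sub>1, \<dots>\<close>: a monomial is a finitely supported exponent
  vector, a polynomial a finitely supported family of coefficients.  The prime field
  with \<open>p\<close> elements is \<open>'p mod_ring\<close> for a type \<open>'p :: prime_card\<close> of cardinality \<open>p\<close>.
\<close>

type_synonym 'a mpolynomial = "(nat \<Rightarrow>\<^sub>0 nat) \<Rightarrow>\<^sub>0 'a"

definition polys_in :: "nat \<Rightarrow> 'a::zero mpolynomial set" where
  "polys_in n = {P. \<forall>m\<in>Poly_Mapping.keys P. Poly_Mapping.keys m \<subseteq> {..<n}}"

definition monomial_degree :: "(nat \<Rightarrow>\<^sub>0 nat) \<Rightarrow> nat" where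
  "monomial_degree m = (\<Sum>i\<in>Poly_Mapping.keys m. Poly_Mapping.lookup m i)"

definition total_degree :: "'a::zero mpolynomial \<Rightarrow> nat" where
  "total_degree P = Max (insert 0 (monomial_degree ` Poly_Mapping.keys P))"

definition poly_fun :: "'a::comm_semiring_1 mpolynomial \<Rightarrow> (nat \<Rightarrow> 'a) \<Rightarrow> 'a" where
  "poly_fun P a =
     (\<Sum>m\<in>Poly_Mapping.keys P. Poly_Mapping.lookup P m *
        (\<Prod>i\<in>Poly_Mapping.keys m. a i ^ Poly_Mapping.lookup m i))"

definition points :: "nat \<Rightarrow> (nat \<Rightarrow> 'a) set" where
  "points n = {..<n} \<rightarrow>\<^sub>E UNIV"

text \<open>
  The degree of a function, as opposed to that of a polynomial expression: over a finite
  field different polynomials may define the same function, and the least degree counts.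
\<close>

definition fun_degree :: "nat \<Rightarrow> ((nat \<Rightarrow> 'a::comm_semiring_1) \<Rightarrow> 'a) \<Rightarrow> nat" where
  "fun_degree n f =
     (LEAST d. \<exists>P\<in>polys_in n. total_degree P = d \<and> (\<forall>a\<in>points n. poly_fun P a = f a))"

text \<open>
  A field element is used as an exponent through its representative in \<open>{0..<p}\<close>.
\<close>

definition bias :: "nat \<Rightarrow> ((nat \<Rightarrow> 'p::prime_card mod_ring) \<Rightarrow> 'p mod_ring) \<Rightarrow> real" where
  "bias n f =
     (let \<omega> = exp (2 * complex_of_real pi * \<i> / of_nat CARD('p mod_ring))
      in cmod ((\<Sum>a\<in>points n. \<omega> powi to_int_mod_ring (f a))
               / of_nat (card (points n :: (nat \<Rightarrow> 'p mod_ring) set))))"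

end

theory Submission
  imports Defs "HOL-Library.Function_Algebras" "HOL-Analysis.Convex"
begin

text \<open>
  Let \<open>T\<close> be the symmetric trilinear form given by the third differences of \<open>f\<close>, and \<open>L = ln (1 / \<delta>)\<close>.
  Applying Cauchy--Schwarz twice, \<open>\<delta>\<^sup>4\<close> is at most the average of \<open>p\<close> to the power \<open>- rank (T y)\<close>,
  so a set \<open>A\<close> of directions of density \<open>\<delta>\<^sup>4 / 2\<close> has \<open>rank (T y) = O(L)\<close>.

  No Bogolyubov-type theorem is needed to pass from \<open>A\<close> to a subspace.  Suppose all forms \<open>T y\<close>,
  \<open>y \<in> A\<close>, have rank at most \<open>r\<close> on a subspace \<open>K\<close>, and consider the popular differences of \<open>A\<close>.
  If they all have rank at most \<open>2 r / 3\<close>, replace \<open>A\<close> by them.  Otherwise some popular difference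
  \<open>y\<^sub>1\<close> has rank \<open>r\<^sub>1 > 2 r / 3\<close>; then replace \<open>A\<close> by \<open>A \<inter> (A - y\<^sub>1)\<close> and \<open>K\<close> by the radical of
  \<open>T y\<^sub>1\<close> in \<open>K\<close>, on which the rank drops to \<open>r - r\<^sub>1 / 2\<close>.  In total \<open>K\<close> loses codimension at most
  \<open>2 r\<close>, while the density of \<open>A\<close> is essentially squared \<open>O(log r)\<close> times, with few enough rounds
  that the exponent grows by a factor \<open>O(r\<^sup>2)\<close> only.  Once the rank is \<open>0\<close>, \<open>T\<close> vanishes on
  \<open>V \<times> K \<times> K\<close> for subspaces \<open>K\<close> of codimension \<open>O(L)\<close> and \<open>V\<close> of codimension \<open>O(L\<^sup>3)\<close>.

  Splitting off the linear forms that define \<open>K\<close> reduces \<open>f\<close> to its restriction to \<open>K\<close>, which is a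
  cubic on a complement of \<open>K \<inter> V\<close> in \<open>K\<close> plus a function without third differences; the latter is
  quadratic in every characteristic and is absorbed as \<open>1 * q\<close>.
\<close>

text \<open>As simp rules these eta-expand sums of vectors inside larger terms.\<close>

declare plus_fun_apply [simp del] zero_fun_apply [simp del]

section \<open>Symmetric trilinear forms on finite groups\<close>

definition add_subgroup :: "'v::ab_group_add set \<Rightarrow> bool" where
  "add_subgroup H \<longleftrightarrow> 0 \<in> H \<and> (\<forall>x\<in>H. \<forall>y\<in>H. x - y \<in> H)"

lemma add_subgroup_zero: "add_subgroup H \<Longrightarrow> 0 \<in> H"
  and add_subgroup_diff: "add_subgroup H \<Longrightarrow> x \<in> H \<Longrightarrow> y \<in> H \<Longrightarrow> x - y \<in> H"
  by (auto simp: add_subgroup_def)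

lemma add_subgroup_uminus: "add_subgroup H \<Longrightarrow> x \<in> H \<Longrightarrow> - x \<in> H"
  using add_subgroup_diff[of H 0 x] add_subgroup_zero[of H] by simp

lemma add_subgroup_add: "add_subgroup H \<Longrightarrow> x \<in> H \<Longrightarrow> y \<in> H \<Longrightarrow> x + y \<in> H"
  using add_subgroup_diff[of H x "- y"] add_subgroup_uminus[of H y] by simp

lemma add_subgroup_Int: "add_subgroup H \<Longrightarrow> add_subgroup K \<Longrightarrow> add_subgroup (H \<inter> K)"
  by (auto simp: add_subgroup_def)

lemma add_subgroup_sum:
  "add_subgroup H \<Longrightarrow> (\<And>i. i \<in> I \<Longrightarrow> x i \<in> H) \<Longrightarrow> sum x I \<in> H"
  by (induction I rule: infinite_finite_induct) (auto simp: add_subgroup_zero add_subgroup_add)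

lemma add_subgroup_card_pos: "add_subgroup H \<Longrightarrow> finite H \<Longrightarrow> card H > 0"
  using add_subgroup_zero card_gt_0_iff by blast

text \<open>Two points in one fibre of the addition map from \<open>A \<times> B\<close> to
  \<open>P\<close> differ in the first coordinate by an element of \<open>A \<inter> B\<close>, so
  no fibre has more than \<open>card (A \<inter> B)\<close> points.\<close>

lemma card_mult_le_card_Int:
  assumes A: "add_subgroup A" and B: "add_subgroup B" and P: "add_subgroup P"
    and "A \<subseteq> P" "B \<subseteq> P" "finite P"
  shows "card A * card B \<le> card P * card (A \<inter> B)"
proof -
  have fin: "finite A" "finite B" using assms finite_subset by blast+
  let ?F = "\<lambda>c. {z \<in> A \<times> B. fst z + snd z = c}"
  have "card (A \<times> B) = (\<Sum>z\<in>A\<times>B. 1)" by simp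
  also have "\<dots> = (\<Sum>c\<in>P. \<Sum>z\<in>?F c. 1)"
    by (rule sum.group[symmetric]) (use assms fin in \<open>auto intro!: add_subgroup_add[OF P]\<close>)
  also have "\<dots> \<le> (\<Sum>c\<in>P. card (A \<inter> B))"
  proof (rule sum_mono)
    fix c
    show "(\<Sum>z\<in>?F c. 1) \<le> card (A \<inter> B)"
    proof (cases "?F c = {}")
      case False
      then obtain a b where ab: "a \<in> A" "b \<in> B" "a + b = c" by auto
      have "inj_on (\<lambda>z. fst z - a) (?F c)"
        by (rule inj_onI) (auto simp: prod_eq_iff)
      moreover have "(\<lambda>z. fst z - a) ` ?F c \<subseteq> A \<inter> B"
      proof clarify
        fix a' b' assume *: "a' \<in> A" "b' \<in> B" "c = fst (a', b') + snd (a', b')"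
        have "a' - a = b - b'" using * ab by (simp add: algebra_simps)
        then show "fst (a', b') - a \<in> A \<inter> B"
          using add_subgroup_diff[OF A, of a' a] add_subgroup_diff[OF B, of b b'] * ab by simp
      qed
      ultimately show ?thesis using card_inj_on_le[of _ "?F c" "A \<inter> B"] fin by simp
    qed (simp only: sum.empty)
  qed
  finally show ?thesis by (simp add: card_cartesian_product)
qed

text \<open>A translate of \<open>H\<close> by an element of \<open>K\<close> outside
  \<open>H\<close> lies in \<open>K\<close> and is disjoint from \<open>H\<close>.\<close>

lemma proper_subgroup_card:
  assumes H: "add_subgroup H" and K: "add_subgroup K" and "H \<subset> K" "finite K"
  shows "2 * card H \<le> card K"
proof -
  obtain z where z: "z \<in> K" "z \<notin> H" using assms by blast
  have fin: "finite H" using assms finite_subset by blast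
  have "H \<inter> (+) z ` H = {}"
  proof (rule ccontr)
    assume "\<not> ?thesis"
    then obtain h where "h \<in> H" "z + h \<in> H" by auto
    then show False using add_subgroup_diff[OF H, of "z + h" h] z by simp
  qed
  then have "card (H \<union> (+) z ` H) = card H + card ((+) z ` H)"
    using fin by (intro card_Un_disjoint) auto
  also have "card ((+) z ` H) = card H" by (intro card_image) auto
  finally have "2 * card H = card (H \<union> (+) z ` H)" by simp
  also have "\<dots> \<le> card K"
    using z assms by (intro card_mono) (auto intro: add_subgroup_add[OF K])
  finally show ?thesis .
qed

text \<open>In \<open>low_rank_structure\<close> this extracts \<open>Q \<ge> 1\<close> from a
  single element of \<open>A\<close>; comparing powers of \<open>Q\<close> rests on it.\<close>

lemma one_le_of_card_le_mult:
  fixes Q :: real and a b :: nat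
  assumes "real a \<le> Q * real b" "b \<le> a" "a > 0"
  shows "Q \<ge> 1"
proof (rule ccontr)
  assume "\<not> Q \<ge> 1"
  then have "(1 - Q) * real b \<ge> 0" by simp
  then have "a = b" using assms by (simp add: algebra_simps)
  with assms \<open>\<not> Q \<ge> 1\<close> show False by simp
qed

text \<open>Additivity is assumed in one argument and symmetry carries it to the others. Subspaces
  appear only as subgroups, and cardinalities replace dimensions, so no scalars occur.\<close>

locale symmetric_trilinear =
  fixes G :: "'v::ab_group_add set" and T :: "'v \<Rightarrow> 'v \<Rightarrow> 'v \<Rightarrow> 'b::ab_group_add"
  assumes G: "add_subgroup G" and finite_G: "finite G"
    and add1: "T (x + x') y z = T x y z + T x' y z"
    and sym12: "T x y z = T y x z"
    and sym23: "T x y z = T x z y"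
begin

lemma add2: "T x (y + y') z = T x y z + T x y' z"
  by (metis add1 sym12)

lemma add3: "T x y (z + z') = T x y z + T x y z'"
  by (metis add2 sym23)

lemma zero1 [simp]: "T 0 y z = 0"
  using add1[of 0 0 y z] by simp

lemma zero2 [simp]: "T x 0 z = 0"
  using add2[of x 0 0 z] by simp

lemma diff1: "T (x - x') y z = T x y z - T x' y z"
  using add1[of "x - x'" x' y z] by (simp add: algebra_simps)

lemma diff2: "T x (y - y') z = T x y z - T x y' z"
  using add2[of x "y - y'" y' z] by (simp add: algebra_simps)

text \<open>The kernel of the bilinear form \<open>T y\<close> on \<open>K\<close>. Its index in
  \<open>K\<close> stands for the exponential of the rank of \<open>T y\<close> on
  \<open>K\<close>.\<close>

definition rad :: "'v set \<Rightarrow> 'v \<Rightarrow> 'v set" where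
  "rad K y = {z \<in> K. \<forall>w\<in>K. T y z w = 0}"

lemma rad_subset: "rad K y \<subseteq> K"
  by (auto simp: rad_def)

lemma rad_subgroup: "add_subgroup K \<Longrightarrow> add_subgroup (rad K y)"
  by (auto simp: add_subgroup_def rad_def diff2)

lemma annihilator_subgroup: "add_subgroup {y \<in> G. \<forall>z\<in>K. \<forall>w\<in>K. T y z w = 0}"
  using G by (auto simp: add_subgroup_def diff1)

text \<open>In terms of ranks: \<open>rank M + rank (M + M\<^sub>1) \<ge> rank M\<^sub>1 + 2 rank (M restricted to ker M\<^sub>1)\<close>
  for the forms \<open>M = T y\<close>, \<open>M\<^sub>1 = T y\<^sub>1\<close> on \<open>K\<close>.\<close>

lemma rad_card_ineq:
  fixes K y y1
  assumes K: "add_subgroup K" and fin: "finite K"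
  defines "K1 \<equiv> rad K y1"
  shows "card (rad K y) * card (rad K (y + y1)) * card K1 \<le> card K * (card (rad K1 y))\<^sup>2"
proof -
  \<comment> \<open>\<open>P\<close> is the orthogonal complement of \<open>K1\<close> in
    \<open>K\<close> under \<open>T y\<close>. It contains both radicals because \<open>T y1\<close>
    vanishes on \<open>K \<times> K1\<close>. The count is done first inside \<open>P\<close>, then
    inside \<open>K\<close>.\<close>
  define P where "P = {x \<in> K. \<forall>z\<in>K1. T y x z = 0}"
  define S where "S = rad K1 y"
  have K1: "add_subgroup K1" "K1 \<subseteq> K" unfolding K1_def using rad_subgroup[OF K] rad_subset by auto
  have P: "add_subgroup P" "P \<subseteq> K" using K by (auto simp: add_subgroup_def P_def diff2)
  have fins: "finite K1" "finite P" "finite S"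
    using K1(2) P(2) rad_subset[of K1 y] by (auto simp: S_def intro: finite_subset[OF _ fin])
  have R: "rad K y \<subseteq> P" using K1 by (auto simp: P_def rad_def)
  have R': "rad K (y + y1) \<subseteq> P"
  proof
    fix x assume x: "x \<in> rad K (y + y1)"
    have "T y x z = 0" if z: "z \<in> K1" for z
    proof -
      have "T y x z + T y1 x z = 0" using x z K1 by (auto simp: rad_def add1)
      moreover have "T y1 x z = 0" using z x unfolding K1_def rad_def by (auto simp: sym23[of y1 x])
      ultimately show ?thesis by simp
    qed
    then show "x \<in> P" using x by (auto simp: P_def rad_def)
  qed
  have RS: "rad K y \<inter> rad K (y + y1) \<subseteq> S"
    using K1(2) by (auto simp: S_def K1_def rad_def add1)
  have "card (rad K y) * card (rad K (y + y1)) \<le> card P * card (rad K y \<inter> rad K (y + y1))"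
    by (rule card_mult_le_card_Int) (use rad_subgroup[OF K] P R R' fins in auto)
  also have "\<dots> \<le> card P * card S" using card_mono[OF fins(3) RS] by simp
  finally have 1: "card (rad K y) * card (rad K (y + y1)) \<le> card P * card S" .
  have "card P * card K1 \<le> card K * card (P \<inter> K1)"
    by (rule card_mult_le_card_Int) (use P K1 K fin in auto)
  also have "P \<inter> K1 = S" using K1 by (auto simp: P_def S_def rad_def)
  finally have 2: "card P * card K1 \<le> card K * card S" .
  have "card (rad K y) * card (rad K (y + y1)) * card K1 \<le> card P * card S * card K1"
    using 1 by (rule mult_right_mono) simp
  also have "\<dots> = card P * card K1 * card S" by simp
  also have "\<dots> \<le> card K * card S * card S" using 2 by (rule mult_right_mono) simp
  finally show ?thesis by (simp add: power2_eq_square S_def)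
qed

text \<open>Directions with full radical form a proper subgroup, hence at most half of
  \<open>G\<close>; every other radical has density at most 1/2. The average density is therefore at
  most 3/4. This keeps the bias of a genuine cubic away from 1, so that
  \<open>ln (1 / \<delta>)\<close> is bounded below.\<close>

lemma sum_rad_le_three_quarters:
  assumes "x \<in> G" "y \<in> G" "z \<in> G" "T x y z \<noteq> 0"
  shows "4 * (\<Sum>h\<in>G. real (card (rad G h))) \<le> 3 * (real (card G))\<^sup>2"
proof -
  let ?n = "real (card G)"
  define V where "V = {y \<in> G. \<forall>z\<in>G. \<forall>w\<in>G. T y z w = 0}"
  have V: "add_subgroup V" "V \<subset> G"
    unfolding V_def using annihilator_subgroup assms by blast+
  have V2: "2 * card V \<le> card G" by (rule proper_subgroup_card[OF V(1) G V(2) finite_G])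
  have le: "card (rad G h) \<le> card G" for h by (rule card_mono[OF finite_G rad_subset])
  have half: "2 * card (rad G h) \<le> card G" if "h \<in> G - V" for h
    by (rule proper_subgroup_card[OF rad_subgroup[OF G] G _ finite_G])
       (use that in \<open>auto simp: rad_def V_def\<close>)
  have "(\<Sum>h\<in>G. 2 * real (card (rad G h))) \<le> (\<Sum>h\<in>G. ?n + (if h \<in> V then ?n else 0))"
  proof (rule sum_mono)
    fix h assume h: "h \<in> G"
    show "2 * real (card (rad G h)) \<le> ?n + (if h \<in> V then ?n else 0)"
    proof (cases "h \<in> V")
      case True then show ?thesis using le[of h] by simp
    next
      case False then show ?thesis using half[of h] h by simp
    qed
  qed
  also have "\<dots> = ?n * ?n + real (card V) * ?n"
    using finite_G V(2) by (simp add: sum.distrib sum.If_cases Int_absorb1 less_imp_le)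
  also have "2 * (?n * ?n + real (card V) * ?n) \<le> 3 * ?n\<^sup>2"
    using V2 mult_right_mono[of "2 * real (card V)" ?n ?n] by (simp add: power2_eq_square algebra_simps)
  finally show ?thesis by (simp add: sum_distrib_left[symmetric])
qed

text \<open>Directions outside \<open>A\<close> have radicals smaller than
  \<open>\<epsilon> * card G / 2\<close> and account for at most half of the lower bound on the sum;
  each direction in \<open>A\<close> contributes at most \<open>card G\<close>.\<close>

lemma many_large_radicals:
  assumes \<epsilon>: "\<epsilon> * (real (card G))\<^sup>2 \<le> (\<Sum>h\<in>G. real (card (rad G h)))" "\<epsilon> > 0"
  defines "A \<equiv> {h \<in> G. real (card G) \<le> 2 / \<epsilon> * real (card (rad G h))}"
  shows "real (card G) \<le> 2 / \<epsilon> * real (card A)"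
proof -
  let ?n = "real (card G)"
  have n: "?n > 0" using add_subgroup_card_pos[OF G finite_G] by simp
  have le: "card (rad G h) \<le> card G" for h by (rule card_mono[OF finite_G rad_subset])
  have GA: "G \<inter> A = A" by (auto simp: A_def)
  have "(\<Sum>h\<in>G. real (card (rad G h))) \<le> (\<Sum>h\<in>G. (if h \<in> A then ?n else 0) + \<epsilon> * ?n / 2)"
  proof (rule sum_mono)
    fix h assume h: "h \<in> G"
    show "real (card (rad G h)) \<le> (if h \<in> A then ?n else 0) + \<epsilon> * ?n / 2"
    proof (cases "h \<in> A")
      case True
      have "0 \<le> \<epsilon> * ?n / 2" using \<epsilon>(2) by simp
      then show ?thesis using True le[of h] by simp
    next
      case False
      then show ?thesis using h \<epsilon>(2) by (simp add: A_def field_simps)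
    qed
  qed
  also have "\<dots> = real (card A) * ?n + ?n * (\<epsilon> * ?n / 2)"
    using finite_G GA by (simp add: sum.distrib sum.If_cases)
  finally have "\<epsilon> * ?n\<^sup>2 \<le> real (card A) * ?n + ?n * (\<epsilon> * ?n / 2)" using \<epsilon>(1) by linarith
  then have "?n * (\<epsilon> * ?n) \<le> ?n * (2 * real (card A))" by (simp add: power2_eq_square algebra_simps)
  then have "\<epsilon> * ?n \<le> 2 * real (card A)" using n by simp
  then show ?thesis using \<epsilon>(2) by (simp add: field_simps)
qed

text \<open>The pairs in \<open>A \<times> A\<close> are distributed over their differences.
  Unpopular differences receive at most half of the pairs and each popular one at most
  \<open>card A\<close>, so at least \<open>card A / 2\<close> differences are popular.\<close>

lemma popular_differences:
  fixes N :: real and A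
  assumes A: "A \<subseteq> G" "real (card G) \<le> N * real (card A)" and N: "N > 0"
  defines "D \<equiv> {y \<in> G. real (card G) \<le> 2 * N\<^sup>2 * real (card {x \<in> A. x + y \<in> A})}"
  shows "real (card G) \<le> 2 * N * real (card D)"
proof -
  have finA: "finite A" using A finite_G finite_subset by blast
  have DG: "D \<subseteq> G" by (auto simp: D_def)
  have finD: "finite D" using DG finite_G finite_subset by blast
  let ?r = "\<lambda>y. card {x \<in> A. x + y \<in> A}"
  have "(\<Sum>y\<in>G. ?r y) = (\<Sum>y\<in>G. \<Sum>x\<in>A. if x + y \<in> A then 1 else 0)"
    using finA by (simp add: sum.inter_filter[symmetric])
  also have "\<dots> = (\<Sum>x\<in>A. \<Sum>y\<in>G. if x + y \<in> A then 1 else 0)" by (rule sum.swap)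
  also have "\<dots> = (\<Sum>x\<in>A. card A)"
  proof (rule sum.cong[OF refl])
    fix x assume x: "x \<in> A"
    have "(\<Sum>y\<in>G. if x + y \<in> A then 1 else 0) = card {y \<in> G. x + y \<in> A}"
      using finite_G by (simp add: sum.inter_filter[symmetric])
    also have "\<dots> = card A"
    proof (rule bij_betw_same_card[of "\<lambda>y. x + y"], rule bij_betw_imageI)
      show "(\<lambda>y. x + y) ` {y \<in> G. x + y \<in> A} = A"
      proof (intro equalityI subsetI)
        fix a assume a: "a \<in> A"
        have "a - x \<in> G" using a x A add_subgroup_diff[OF G] by blast
        then show "a \<in> (\<lambda>y. x + y) ` {y \<in> G. x + y \<in> A}"
          using a by (intro image_eqI[of _ _ "a - x"]) auto
      qed auto
    qed (auto simp: inj_on_def)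
    finally show "(\<Sum>y\<in>G. if x + y \<in> A then 1 else 0) = card A" .
  qed
  finally have total: "(\<Sum>y\<in>G. ?r y) = card A * card A" by simp
  have r_le: "?r y \<le> card A" for y using finA by (intro card_mono) auto
  have "real (card A) * real (card A) = (\<Sum>y\<in>G. real (?r y))"
    using arg_cong[OF total, of real] by simp
  also have "\<dots> = (\<Sum>y\<in>D. real (?r y)) + (\<Sum>y\<in>G - D. real (?r y))"
    using sum.subset_diff[OF DG finite_G, of "\<lambda>y. real (?r y)"] by simp
  also have "(\<Sum>y\<in>D. real (?r y)) \<le> real (card D) * real (card A)"
    using sum_bounded_above[of D "\<lambda>y. real (?r y)" "real (card A)"] r_le by simp
  also have "(\<Sum>y\<in>G - D. real (?r y)) \<le> (\<Sum>y\<in>G - D. real (card G) / (2 * N\<^sup>2))"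
    using N by (intro sum_mono) (auto simp: D_def field_simps)
  also have "\<dots> \<le> (\<Sum>y\<in>G. real (card G) / (2 * N\<^sup>2))"
    using finite_G N by (intro sum_mono2) auto
  also have "\<dots> = real (card G) * real (card G) / (2 * N\<^sup>2)" by simp
  also have "\<dots> \<le> (N * real (card A)) * real (card G) / (2 * N\<^sup>2)"
    using A(2) N by (intro divide_right_mono mult_right_mono) auto
  also have "\<dots> = real (card A) * real (card G) / (2 * N)"
    using N by (simp add: power2_eq_square)
  finally have *: "real (card A) * real (card A) \<le>
      real (card D) * real (card A) + real (card A) * real (card G) / (2 * N)" by simp
  have pos: "card A > 0" using A add_subgroup_card_pos[OF G finite_G] N
    by (metis gr0I mult_zero_right not_less of_nat_0 of_nat_0_less_iff)
  have "real (card A) * (real (card A)) \<le> real (card A) * (real (card D) + real (card G) / (2 * N))"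
    using * by (simp add: algebra_simps)
  then have "real (card A) \<le> real (card D) + real (card G) / (2 * N)"
    using pos by simp
  then have "2 * N * real (card A) \<le> 2 * N * (real (card D) + real (card G) / (2 * N))"
    using N by (intro mult_left_mono) auto
  then have "2 * N * real (card A) \<le> 2 * N * real (card D) + real (card G)"
    using N by (simp add: distrib_left)
  then show ?thesis using A(2) by linarith
qed

text \<open>Induction on the number \<open>k\<close> of rounds. \<open>Q\<close> is the exponential
  of the rank bound; a round lowers it to at most \<open>Q powr (2/3)\<close>, which uses up one
  factor \<open>3 / 2\<close> in the exponent. Twice the inverse density is at most squared by a
  round, whence the power \<open>2 ^ k\<close>. The index of \<open>K'\<close> stays below
  \<open>Q\<^sup>2\<close>, since passing to a radical of index \<open>i\<close> replaces
  \<open>Q\<close> by \<open>Q / sqrt i\<close>.\<close>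

lemma low_rank_structure:
  fixes N Q :: real
  assumes "A \<subseteq> G" "real (card G) \<le> N * real (card A)" "N \<ge> 1"
    and "add_subgroup K" "K \<subseteq> G"
    and "\<And>y. y \<in> A \<Longrightarrow> real (card K) \<le> Q * real (card (rad K y))"
    and "Q < 2 powr ((3 / 2) ^ k)"
  shows "\<exists>K' V. add_subgroup K' \<and> K' \<subseteq> K \<and> add_subgroup V \<and> V \<subseteq> G \<and>
     real (card K) \<le> Q\<^sup>2 * real (card K') \<and> real (card G) \<le> (2 * N) ^ (2 ^ k) * real (card V) \<and>
     (\<forall>y\<in>V. \<forall>z\<in>K'. \<forall>w\<in>K'. T y z w = 0)"
  using assms
proof (induction k arbitrary: A N Q K)
  case (0 A N Q K)
  define V where "V = {y \<in> G. \<forall>z\<in>K. \<forall>w\<in>K. T y z w = 0}"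
  have finK: "finite K" using 0 finite_G finite_subset by blast
  have finV: "finite V" using finite_G by (simp add: V_def)
  have cK: "card K > 0" using add_subgroup_card_pos[OF 0(4) finK] .
  have "A \<noteq> {}" using 0(2) add_subgroup_card_pos[OF G finite_G] by auto
  then obtain y where y: "y \<in> A" by blast
  have "real (card K) \<le> Q * real (card (rad K y))" using 0(6) y .
  moreover have le: "card (rad K y) \<le> card K" using card_mono[OF finK rad_subset] .
  ultimately have Q1: "Q \<ge> 1"
    using cK by (rule one_le_of_card_le_mult)
  \<comment> \<open>Here \<open>Q < 2\<close>, while a proper subgroup has index at least 2, so
    every radical is all of \<open>K\<close>.\<close>
  have AV: "A \<subseteq> V"
  proof
    fix y assume y: "y \<in> A"
    have "rad K y = K"
    proof (rule ccontr)
      assume "rad K y \<noteq> K"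
      then have "2 * card (rad K y) \<le> card K"
        using rad_subgroup[OF 0(4)] rad_subset 0(4) finK by (intro proper_subgroup_card) auto
      moreover have "real (card K) \<le> Q * real (card (rad K y))" using 0(6)[OF y] .
      moreover have "(2 - Q) * real (card (rad K y)) > 0"
        using 0(7) add_subgroup_card_pos[OF rad_subgroup[OF 0(4)] finite_subset[OF rad_subset finK]]
        by simp
      ultimately show False by (simp add: algebra_simps)
    qed
    then show "y \<in> V" using y 0(1) by (auto simp: V_def rad_def)
  qed
  have "real (card G) \<le> N * real (card A)" using 0 by simp
  also have "\<dots> \<le> (2 * N) * real (card V)"
    using 0(3) card_mono[OF finV AV] by (intro mult_mono) auto
  finally have "real (card G) \<le> (2 * N) ^ (2 ^ 0) * real (card V)" by simp
  moreover have "real (card K) \<le> Q\<^sup>2 * real (card K)"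
    using Q1 mult_right_mono[of 1 "Q\<^sup>2" "real (card K)"] by simp
  moreover have "add_subgroup V" unfolding V_def by (rule annihilator_subgroup)
  moreover have "V \<subseteq> G" "\<forall>y\<in>V. \<forall>z\<in>K. \<forall>w\<in>K. T y z w = 0" by (auto simp: V_def)
  ultimately show ?case using 0(4) by blast
next
  case (Suc k A N Q K)
  define D where "D = {y \<in> G. real (card G) \<le> 2 * N\<^sup>2 * real (card {x \<in> A. x + y \<in> A})}"
  have D: "real (card G) \<le> 2 * N * real (card D)"
    unfolding D_def using Suc.prems by (intro popular_differences) auto
  have finK: "finite K" using Suc.prems finite_G finite_subset by blast
  have cK: "card K > 0" using add_subgroup_card_pos[OF Suc.prems(4) finK] .
  have "A \<noteq> {}" using Suc.prems(2) add_subgroup_card_pos[OF G finite_G] by auto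
  then obtain y0 where y0: "y0 \<in> A" by blast
  have "real (card K) \<le> Q * real (card (rad K y0))" using Suc.prems(6) y0 .
  moreover have "card (rad K y0) \<le> card K" using card_mono[OF finK rad_subset] .
  ultimately have Q1: "Q \<ge> 1"
    using cK by (rule one_le_of_card_le_mult)
  have "Q powr (2/3) < (2 powr ((3 / 2) ^ Suc k)) powr (2/3)"
    using Suc.prems(7) Q1 by (intro powr_less_mono2) auto
  also have "\<dots> = 2 powr ((3 / 2) ^ k)" by (simp add: powr_powr)
  finally have Q23: "Q powr (2/3) < 2 powr ((3 / 2) ^ k)" .
  \<comment> \<open>The new inverse density is \<open>2 * N\<close> or \<open>2 * N\<^sup>2\<close>.
    Doubled, it is at most \<open>(2 * N)\<^sup>2\<close> in both cases, and the square is absorbed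
    by passing from \<open>2 ^ k\<close> to \<open>2 ^ Suc k\<close>.\<close>
  have "N * 1 \<le> N * N" using Suc.prems(3) by (intro mult_left_mono) auto
  then have N2: "2 * (2 * N) \<le> (2 * N)\<^sup>2" "2 * (2 * N\<^sup>2) = (2 * N)\<^sup>2" "N\<^sup>2 \<ge> 1"
    using Suc.prems(3) by (auto simp: power2_eq_square intro: order_trans)
  have pow: "(2 * (2 * N\<^sup>2)) ^ (2 ^ k) = (2 * N) ^ (2 ^ Suc k)"
    unfolding N2(2) by (simp add: power_mult)
  have pow': "(2 * (2 * N)) ^ (2 ^ k) \<le> (2 * N) ^ (2 ^ Suc k)"
    using power_mono[OF N2(1), of "2 ^ k"] Suc.prems(3) by (simp add: power_mult)
  show ?case
  proof (cases "\<forall>y\<in>D. real (card K) \<le> Q powr (2/3) * real (card (rad K y))")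
    case True
    have "\<exists>K' V. add_subgroup K' \<and> K' \<subseteq> K \<and> add_subgroup V \<and> V \<subseteq> G \<and>
     real (card K) \<le> (Q powr (2/3))\<^sup>2 * real (card K') \<and>
     real (card G) \<le> (2 * (2 * N)) ^ (2 ^ k) * real (card V) \<and>
     (\<forall>y\<in>V. \<forall>z\<in>K'. \<forall>w\<in>K'. T y z w = 0)"
      using True Suc.prems D Q23 by (intro Suc.IH[of D "2 * N" K]) (auto simp: D_def)
    then obtain K' V where KV: "add_subgroup K'" "K' \<subseteq> K" "add_subgroup V" "V \<subseteq> G"
      "real (card K) \<le> (Q powr (2/3))\<^sup>2 * real (card K')"
      "real (card G) \<le> (2 * (2 * N)) ^ (2 ^ k) * real (card V)"
      "\<forall>y\<in>V. \<forall>z\<in>K'. \<forall>w\<in>K'. T y z w = 0" by blast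
    have "Q powr (2/3) \<le> Q powr 1" using Q1 by (intro powr_mono) auto
    then have "(Q powr (2/3))\<^sup>2 \<le> Q\<^sup>2" using Q1 by (intro power_mono) auto
    then have "(Q powr (2/3))\<^sup>2 * real (card K') \<le> Q\<^sup>2 * real (card K')" by (intro mult_right_mono) auto
    then have "real (card K) \<le> Q\<^sup>2 * real (card K')" using KV(5) by linarith
    moreover have "real (card G) \<le> (2 * N) ^ (2 ^ Suc k) * real (card V)"
      using KV(6) mult_right_mono[OF pow', of "real (card V)"] by linarith
    ultimately show ?thesis using KV by blast
  next
    case False
    then obtain y1 where y1: "y1 \<in> D" "real (card K) > Q powr (2/3) * real (card (rad K y1))" by force
    define K1 where "K1 = rad K y1"
    define A1 where "A1 = {x \<in> A. x + y1 \<in> A}"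
    have K1: "add_subgroup K1" "K1 \<subseteq> K" unfolding K1_def using rad_subgroup[OF Suc.prems(4)] rad_subset by auto
    have cK1: "card K1 > 0" using add_subgroup_card_pos[OF K1(1)] finite_subset[OF K1(2) finK] by simp
    define i where "i = real (card K) / real (card K1)"
    have i: "i > Q powr (2/3)" "i > 0" "real (card K) = i * real (card K1)"
      using y1(2) cK1 cK by (auto simp: i_def K1_def field_simps)
    \<comment> \<open>As \<open>i\<close> is the exponential of the rank of \<open>T y1\<close>,
      dividing by \<open>sqrt i\<close> subtracts half of that rank from the bound.\<close>
    define Q' where "Q' = Q / sqrt i"
    have "Q powr (1/3) = sqrt (Q powr (2/3))"
      using Q1 by (simp add: powr_half_sqrt[symmetric] powr_powr)
    also have "\<dots> \<le> sqrt i" using i by simp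
    finally have "Q / sqrt i \<le> Q / (Q powr (1/3))" using Q1 i by (intro divide_left_mono) auto
    also have "\<dots> = Q powr (2/3)" using Q1 powr_diff[of Q 1 "1/3"] by simp
    finally have Q': "Q' < 2 powr ((3 / 2) ^ k)" using Q23 by (simp add: Q'_def)
    have Q'sq: "Q'\<^sup>2 * i = Q\<^sup>2" "Q' \<ge> 0" using i Q1 by (auto simp: Q'_def power_divide)
    \<comment> \<open>Both \<open>y\<close> and \<open>y + y1\<close> lie in \<open>A\<close>, so
      both of their radicals in \<open>K\<close> are large, and \<open>rad_card_ineq\<close>
      converts this into a bound for the radical in \<open>K1\<close>.\<close>
    have rank: "real (card K1) \<le> Q' * real (card (rad K1 y))" if y: "y \<in> A1" for y
    proof -
      let ?S = "real (card (rad K1 y))"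
      have "real (card K) \<le> Q * real (card (rad K y))" "real (card K) \<le> Q * real (card (rad K (y + y1)))"
        using y Suc.prems(6) by (auto simp: A1_def)
      then have "real (card K) * real (card K) \<le> (Q * real (card (rad K y))) * (Q * real (card (rad K (y + y1))))"
        using Q1 by (intro mult_mono) auto
      then have "real (card K) * real (card K) * real (card K1) \<le>
         (Q * real (card (rad K y))) * (Q * real (card (rad K (y + y1)))) * real (card K1)"
        by (rule mult_right_mono) simp
      also have "\<dots> = Q\<^sup>2 * real (card (rad K y) * card (rad K (y + y1)) * card K1)"
        by (simp add: power2_eq_square)
      also have "\<dots> \<le> Q\<^sup>2 * real (card K * (card (rad K1 y))\<^sup>2)"
        using rad_card_ineq[OF Suc.prems(4) finK, of y y1] unfolding K1_def
        by (intro mult_left_mono of_nat_mono) auto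
      finally have "real (card K) * (real (card K) * real (card K1)) \<le> real (card K) * (Q\<^sup>2 * ?S\<^sup>2)"
        by (simp add: algebra_simps)
      then have "real (card K) * real (card K1) \<le> Q\<^sup>2 * ?S\<^sup>2" using cK by simp
      then have "i * (real (card K1))\<^sup>2 \<le> i * (Q' * ?S)\<^sup>2"
        using i(3) Q'sq(1)[symmetric] by (simp add: power2_eq_square[of "real (card K1)"] power_mult_distrib mult_ac)
      then have "(real (card K1))\<^sup>2 \<le> (Q' * ?S)\<^sup>2" using i(2) by simp
      then show ?thesis by (rule power2_le_imp_le) (use Q'sq in auto)
    qed
    have "\<exists>K' V. add_subgroup K' \<and> K' \<subseteq> K1 \<and> add_subgroup V \<and> V \<subseteq> G \<and>
     real (card K1) \<le> Q'\<^sup>2 * real (card K') \<and>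
     real (card G) \<le> (2 * (2 * N\<^sup>2)) ^ (2 ^ k) * real (card V) \<and>
     (\<forall>y\<in>V. \<forall>z\<in>K'. \<forall>w\<in>K'. T y z w = 0)"
    proof (rule Suc.IH)
      show "A1 \<subseteq> G" using Suc.prems(1) by (auto simp: A1_def)
      show "real (card G) \<le> 2 * N\<^sup>2 * real (card A1)" using y1(1) by (simp add: A1_def D_def)
      show "K1 \<subseteq> G" using K1 Suc.prems by blast
    qed (use K1 N2 Q' rank in auto)
    then obtain K' V where KV: "add_subgroup K'" "K' \<subseteq> K1" "add_subgroup V" "V \<subseteq> G"
      "real (card K1) \<le> Q'\<^sup>2 * real (card K')"
      "real (card G) \<le> (2 * (2 * N\<^sup>2)) ^ (2 ^ k) * real (card V)"
      "\<forall>y\<in>V. \<forall>z\<in>K'. \<forall>w\<in>K'. T y z w = 0" by blast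
    have "real (card K) \<le> i * (Q'\<^sup>2 * real (card K'))"
      using KV(5) i by (simp add: mult_left_mono)
    also have "\<dots> = Q\<^sup>2 * real (card K')" using Q'sq(1) by (simp add: mult_ac)
    finally have "real (card K) \<le> Q\<^sup>2 * real (card K')" .
    moreover have "real (card G) \<le> (2 * N) ^ (2 ^ Suc k) * real (card V)" using KV(6) unfolding pow .
    ultimately show ?thesis using KV(1-4,7) K1(2) by blast
  qed
qed

end

section \<open>Functions of bounded degree\<close>

inductive poly_deg_le :: "nat \<Rightarrow> nat \<Rightarrow> ((nat \<Rightarrow> 'a::comm_ring_1) \<Rightarrow> 'a) \<Rightarrow> bool"
  for n where
  const: "poly_deg_le n d (\<lambda>x. c)"
| var: "i < n \<Longrightarrow> poly_deg_le n d q \<Longrightarrow> poly_deg_le n (Suc d) (\<lambda>x. x i * q x)"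
| add: "poly_deg_le n d p \<Longrightarrow> poly_deg_le n d q \<Longrightarrow> poly_deg_le n d (\<lambda>x. p x + q x)"

text \<open>Without constant term, to match the additive functions on \<open>vecs n\<close>.\<close>

definition linear_form :: "nat \<Rightarrow> ((nat \<Rightarrow> 'a::comm_ring_1) \<Rightarrow> 'a) \<Rightarrow> bool" where
  "linear_form n l \<longleftrightarrow> (\<exists>a. l = (\<lambda>x. \<Sum>i<n. a i * x i))"

lemma poly_deg_le_mono: "poly_deg_le n d p \<Longrightarrow> d \<le> e \<Longrightarrow> poly_deg_le n e p"
proof (induction arbitrary: e rule: poly_deg_le.induct)
  case (var i d q)
  then show ?case using poly_deg_le.var[of i n "e - 1" q] by (cases e) auto
qed (auto intro: poly_deg_le.intros)

lemma poly_deg_le_mono_vars: "poly_deg_le n d p \<Longrightarrow> n \<le> m \<Longrightarrow> poly_deg_le m d p"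
  by (induction rule: poly_deg_le.induct) (auto intro: poly_deg_le.intros)

lemma poly_deg_le_cong: "poly_deg_le n d p \<Longrightarrow> (\<And>i. i < n \<Longrightarrow> x i = y i) \<Longrightarrow> p x = p y"
  by (induction rule: poly_deg_le.induct) auto

lemma poly_deg_le_0: "poly_deg_le n d p \<Longrightarrow> d = 0 \<Longrightarrow> p x = p y"
  by (induction rule: poly_deg_le.induct) simp_all

lemma poly_deg_le_sum:
  "(\<And>i. i \<in> I \<Longrightarrow> poly_deg_le n d (p i)) \<Longrightarrow> poly_deg_le n d (\<lambda>x. \<Sum>i\<in>I. p i x)"
  by (induction I rule: infinite_finite_induct) (auto intro: poly_deg_le.intros)

lemma poly_deg_le_mult:
  assumes "poly_deg_le n d p" "poly_deg_le n e q"
  shows "poly_deg_le n (d + e) (\<lambda>x. p x * q x)"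
  using assms(1)
proof (induction rule: poly_deg_le.induct)
  case (const d c)
  have "poly_deg_le n e (\<lambda>x. c * q x)" using assms(2)
  proof (induction rule: poly_deg_le.induct)
    case (const d c')
    show ?case by (rule poly_deg_le.const)
  next
    case (var i d q)
    then show ?case using poly_deg_le.var[OF var(1,3)] by (simp add: mult.left_commute)
  next
    case (add d p q)
    then show ?case using poly_deg_le.add[OF add(3,4)] by (simp add: distrib_left)
  qed
  then show ?case by (rule poly_deg_le_mono) simp
next
  case (var i d p)
  then show ?case using poly_deg_le.var[OF var(1,3)] by (simp add: mult.assoc)
next
  case (add d p p')
  then show ?case using poly_deg_le.add[OF add(3,4)] by (simp add: distrib_right)
qed

lemma poly_deg_le_scale: "poly_deg_le n d q \<Longrightarrow> poly_deg_le n d (\<lambda>x. c * q x)"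
  using poly_deg_le_mult[OF poly_deg_le.const[of n 0 c], of d q] by simp

lemma poly_deg_le_var: "i < n \<Longrightarrow> poly_deg_le n 1 (\<lambda>x. x i)"
  using poly_deg_le.var[OF _ poly_deg_le.const, of i n 0 1] by simp

lemma poly_deg_le_linear_form: "linear_form n l \<Longrightarrow> poly_deg_le n 1 l"
  by (auto simp: linear_form_def intro!: poly_deg_le_sum
      poly_deg_le_mult[OF poly_deg_le.const poly_deg_le_var, of _ _ 0, simplified])

lemma linear_form_var: "i < n \<Longrightarrow> linear_form n (\<lambda>x. x i)"
  unfolding linear_form_def
  by (rule exI[of _ "\<lambda>j. if j = i then 1 else 0"]) (simp add: if_distrib[of "\<lambda>a. a * _"] cong: if_cong)

lemma linear_form_mult_right: "linear_form n l \<Longrightarrow> linear_form n (\<lambda>x. l x * c)"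
  unfolding linear_form_def
  by (elim exE, rule_tac x = "\<lambda>i. a i * c" in exI) (simp add: sum_distrib_left sum_distrib_right mult_ac)

lemma linear_form_add: "linear_form n l \<Longrightarrow> linear_form n l' \<Longrightarrow> linear_form n (\<lambda>x. l x + l' x)"
  unfolding linear_form_def
  by (elim exE, rule_tac x = "\<lambda>i. a i + aa i" in exI) (simp add: sum.distrib distrib_right)

lemma linear_form_zero: "linear_form n (\<lambda>x. 0)"
  unfolding linear_form_def by (rule exI[of _ "\<lambda>i. 0"]) simp

lemma linear_form_sum:
  "(\<And>i. i \<in> I \<Longrightarrow> linear_form n (l i)) \<Longrightarrow> linear_form n (\<lambda>x. \<Sum>i\<in>I. l i x)"
  by (induction I rule: infinite_finite_induct) (auto intro: linear_form_add linear_form_zero)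

lemma linear_form_diff: "linear_form n l \<Longrightarrow> linear_form n l' \<Longrightarrow> linear_form n (\<lambda>x. l x - l' x)"
  using linear_form_add[OF _ linear_form_mult_right[of n l' "- 1"]] by simp

lemma poly_deg_le_compose:
  "poly_deg_le m d p \<Longrightarrow> (\<And>i. i < m \<Longrightarrow> linear_form n (\<lambda>x. A x i)) \<Longrightarrow> poly_deg_le n d (\<lambda>x. p (A x))"
proof (induction rule: poly_deg_le.induct)
  case (var i d q)
  then show ?case
    using poly_deg_le_mult[OF poly_deg_le_linear_form[of n "\<lambda>x. A x i"], of d "\<lambda>x. q (A x)"] by simp
qed (auto intro: poly_deg_le.intros)

lemma poly_deg_le_shift: "poly_deg_le n d p \<Longrightarrow> poly_deg_le n d (\<lambda>x. p (x + h))"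
proof (induction rule: poly_deg_le.induct)
  case (var i d q)
  have "poly_deg_le n (Suc d) (\<lambda>x. x i * q (x + h) + h i * q (x + h))"
    by (intro poly_deg_le.add poly_deg_le.var var(1,3) poly_deg_le_scale poly_deg_le_mono[OF var(3)]) simp
  moreover have "(\<lambda>x. (x + h) i * q (x + h)) = (\<lambda>x. x i * q (x + h) + h i * q (x + h))"
    by (intro ext) (simp add: distrib_right plus_fun_apply)
  ultimately show ?case by (simp only:)
qed (auto intro: poly_deg_le.intros)

text \<open>Product rule: the difference of \<open>x i * q x\<close> is \<open>x i\<close> times the
  difference of \<open>q\<close>, plus \<open>h i * q (x + h)\<close>.\<close>

lemma poly_deg_le_difference:
  "poly_deg_le n d p \<Longrightarrow> d = Suc e \<Longrightarrow> poly_deg_le n e (\<lambda>x. p (x + h) - p x)"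
proof (induction arbitrary: e rule: poly_deg_le.induct)
  case (const d c)
  then show ?case using poly_deg_le.const[of n e 0] by simp
next
  case (var i d q)
  then have e: "e = d" by simp
  have "poly_deg_le n d (\<lambda>x. x i * (q (x + h) - q x))"
  \<comment> \<open>For \<open>d = 0\<close> the induction hypothesis is void, but then
    \<open>q\<close> is constant and its difference vanishes.\<close>
  proof (cases d)
    case 0
    then have "q (x + h) - q x = 0" for x using poly_deg_le_0[OF var(2), of "x + h" x] by simp
    then show ?thesis using poly_deg_le.const[of n d 0] by simp
  next
    case (Suc d')
    then show ?thesis using poly_deg_le.var[OF var(1) var(3)[OF Suc]] by (simp only:)
  qed
  then have "poly_deg_le n d (\<lambda>x. x i * (q (x + h) - q x) + h i * q (x + h))"
    by (intro poly_deg_le.add poly_deg_le_scale poly_deg_le_shift var(2))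
  moreover have "(\<lambda>x. (x + h) i * q (x + h) - x i * q x) = (\<lambda>x. x i * (q (x + h) - q x) + h i * q (x + h))"
    by (intro ext) (simp add: algebra_simps plus_fun_apply)
  ultimately show ?case by (simp only: e)
next
  case (add d p q)
  then show ?case using poly_deg_le.add[OF add(3,4)[OF add(5)]] by (simp add: algebra_simps)
qed

text \<open>The quotient by \<open>l\<close> is built with the product rule. The clause for
  \<open>d = 0\<close> compensates the truncated subtraction in \<open>d - 1\<close>: a constant
  needs quotient 0, since otherwise its product with a variable would get a quotient of too high
  degree.\<close>

lemma poly_deg_le_divided_difference:
  assumes l: "linear_form n l" and A: "\<And>i. i < m \<Longrightarrow> linear_form n (\<lambda>x. A x i)"
  shows "poly_deg_le m d p \<Longrightarrow>
    \<exists>q. poly_deg_le n (d - 1) q \<and> (d = 0 \<longrightarrow> q = (\<lambda>x. 0)) \<and>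
        (\<forall>x. p (A x) - p (\<lambda>i. A x i - l x * v i) = l x * q x)"
proof (induction rule: poly_deg_le.induct)
  case (const d c)
  show ?case by (rule exI[of _ "\<lambda>x. 0"]) (simp add: poly_deg_le.const)
next
  case (var i d p)
  then obtain q where q: "poly_deg_le n (d - 1) q" "d = 0 \<Longrightarrow> q = (\<lambda>x. 0)"
     "\<And>x. p (A x) - p (\<lambda>i. A x i - l x * v i) = l x * q x" by auto
  have "linear_form n (\<lambda>x. A x i - l x * v i)"
    by (intro linear_form_diff linear_form_mult_right l A var)
  then have "poly_deg_le n d (\<lambda>x. (A x i - l x * v i) * q x)"
    using q poly_deg_le_mult[OF poly_deg_le_linear_form q(1), of "\<lambda>x. A x i - l x * v i"]
    by (cases d) (auto intro: poly_deg_le.const)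
  then have *: "poly_deg_le n d (\<lambda>x. (A x i - l x * v i) * q x + v i * p (A x))"
    by (intro poly_deg_le.add poly_deg_le_scale poly_deg_le_compose[OF var(2) A])
  have "A x i * p (A x) - (A x i - l x * v i) * p (\<lambda>i. A x i - l x * v i)
      = l x * ((A x i - l x * v i) * q x + v i * p (A x))" for x
  proof -
    have "p (\<lambda>i. A x i - l x * v i) = p (A x) - l x * q x" using q(3)[of x] by (simp add: algebra_simps)
    then show ?thesis by (simp only:) (simp add: algebra_simps)
  qed
  then show ?case using * by auto
next
  case (add d p q)
  then obtain p' q' where
    pq: "poly_deg_le n (d - 1) p'" "d = 0 \<longrightarrow> p' = (\<lambda>x. 0)"
    "poly_deg_le n (d - 1) q'" "d = 0 \<longrightarrow> q' = (\<lambda>x. 0)" and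
    p': "\<And>x. p (A x) - p (\<lambda>i. A x i - l x * v i) = l x * p' x" and
    q': "\<And>x. q (A x) - q (\<lambda>i. A x i - l x * v i) = l x * q' x" by blast
  have "p (A x) + q (A x) - (p (\<lambda>i. A x i - l x * v i) + q (\<lambda>i. A x i - l x * v i)) = l x * (p' x + q' x)" for x
    unfolding distrib_left p'[symmetric] q'[symmetric] by simp
  then show ?case using pq
    by (intro exI[of _ "\<lambda>x. p' x + q' x"]) (auto intro: poly_deg_le.add)
qed

section \<open>Polynomials and the functions they define\<close>

lemma poly_fun_superset:
  assumes "finite A" "Poly_Mapping.keys P \<subseteq> A"
  shows "poly_fun P a = (\<Sum>m\<in>A. Poly_Mapping.lookup P m *
        (\<Prod>i\<in>Poly_Mapping.keys m. a i ^ Poly_Mapping.lookup m i))"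
  unfolding poly_fun_def using assms
  by (intro sum.mono_neutral_left) (auto simp: in_keys_iff)

lemma poly_fun_add: "poly_fun (P + Q) a = poly_fun P a + poly_fun Q a"
proof -
  let ?A = "Poly_Mapping.keys P \<union> Poly_Mapping.keys Q"
  have "Poly_Mapping.keys (P + Q) \<subseteq> ?A" by (rule Poly_Mapping.keys_add)
  then show ?thesis
    by (simp add: poly_fun_superset[of ?A] lookup_add distrib_right sum.distrib)
qed

lemma poly_fun_zero: "poly_fun 0 a = 0"
  by (simp add: poly_fun_def)

lemma poly_fun_sum: "poly_fun (\<Sum>i\<in>I. P i) a = (\<Sum>i\<in>I. poly_fun (P i) a)"
  by (induction I rule: infinite_finite_induct) (auto simp: poly_fun_add poly_fun_zero)

lemma poly_fun_single:
  "poly_fun (Poly_Mapping.single m c) a = c * (\<Prod>i\<in>Poly_Mapping.keys m. a i ^ Poly_Mapping.lookup m i)"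
  by (simp add: poly_fun_superset[of "{m}"])

lemma monomial_superset:
  fixes a :: "nat \<Rightarrow> 'a::comm_semiring_1"
  assumes "finite A" "Poly_Mapping.keys m \<subseteq> A"
  shows "(\<Prod>i\<in>Poly_Mapping.keys m. a i ^ Poly_Mapping.lookup m i) = (\<Prod>i\<in>A. a i ^ Poly_Mapping.lookup m i)"
  using assms by (intro prod.mono_neutral_left) (auto simp: in_keys_iff)

lemma monomial_times_var:
  fixes a :: "nat \<Rightarrow> 'a::comm_semiring_1" and i m
  defines "m' \<equiv> m + Poly_Mapping.single i 1"
  shows "(\<Prod>j\<in>Poly_Mapping.keys m'. a j ^ Poly_Mapping.lookup m' j)
    = a i * (\<Prod>j\<in>Poly_Mapping.keys m. a j ^ Poly_Mapping.lookup m j)"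
proof -
  let ?A = "insert i (Poly_Mapping.keys m)"
  have sub: "Poly_Mapping.keys m' \<subseteq> ?A"
    unfolding m'_def using Poly_Mapping.keys_add[of m "Poly_Mapping.single i 1"] by auto
  have "(\<Prod>j\<in>?A. a j ^ Poly_Mapping.lookup m' j)
      = (\<Prod>j\<in>?A. a j ^ Poly_Mapping.lookup m j * (if j = i then a i else 1))"
    by (intro prod.cong) (auto simp: m'_def lookup_add lookup_single when_def power_add)
  also have "\<dots> = (\<Prod>j\<in>?A. a j ^ Poly_Mapping.lookup m j) * a i"
    by (subst prod.distrib, subst prod.delta) auto
  finally show ?thesis
    using monomial_superset[of ?A m' a] monomial_superset[of ?A m a, OF _ subset_insertI] sub
    by (simp add: mult.commute)
qed

lemma monomial_degree_times_var:
  "monomial_degree (m + Poly_Mapping.single i 1) = Suc (monomial_degree m)"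
proof -
  let ?A = "insert i (Poly_Mapping.keys m)" and ?m = "m + Poly_Mapping.single i 1"
  have sub: "Poly_Mapping.keys ?m \<subseteq> ?A"
    using Poly_Mapping.keys_add[of m "Poly_Mapping.single i 1"] by auto
  have "monomial_degree ?m = (\<Sum>j\<in>?A. Poly_Mapping.lookup ?m j)"
    unfolding monomial_degree_def using sub by (intro sum.mono_neutral_left) (auto simp: in_keys_iff)
  also have "\<dots> = (\<Sum>j\<in>?A. Poly_Mapping.lookup m j + (if j = i then 1 else 0))"
    by (intro sum.cong) (auto simp: lookup_add lookup_single when_def)
  also have "\<dots> = (\<Sum>j\<in>?A. Poly_Mapping.lookup m j) + 1"
    by (subst sum.distrib, subst sum.delta) auto
  also have "(\<Sum>j\<in>?A. Poly_Mapping.lookup m j) = monomial_degree m"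
    unfolding monomial_degree_def by (intro sum.mono_neutral_right) (auto simp: in_keys_iff)
  finally show ?thesis by simp
qed

lemma total_degree_le_iff: "total_degree P \<le> d \<longleftrightarrow> (\<forall>m\<in>Poly_Mapping.keys P. monomial_degree m \<le> d)"
  by (auto simp: total_degree_def)

lemma poly_deg_le_poly_fun:
  fixes P :: "'a::comm_ring_1 mpolynomial"
  assumes "P \<in> polys_in n" "total_degree P \<le> d"
  shows "poly_deg_le n d (poly_fun P)"
proof -
  have mono: "poly_deg_le n (\<Sum>i\<in>I. e i) (\<lambda>x::nat \<Rightarrow> 'a. \<Prod>i\<in>I. x i ^ e i)" if "I \<subseteq> {..<n}" "finite I" for I and e :: "nat \<Rightarrow> nat"
    using that(2,1)
  proof (induction I rule: finite_induct)
    case (insert i I)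
    have "poly_deg_le n k (\<lambda>x::nat \<Rightarrow> 'a. x i ^ k)" for k
    proof (induction k)
      case (Suc k)
      then show ?case using poly_deg_le.var[of i n k] insert by simp
    qed (simp add: poly_deg_le.const)
    then have "poly_deg_le n (e i + sum e I) (\<lambda>x::nat \<Rightarrow> 'a. x i ^ e i * (\<Prod>i\<in>I. x i ^ e i))"
      using insert by (intro poly_deg_le_mult) auto
    then show ?case using insert by simp
  qed (simp add: poly_deg_le.const)
  have "poly_deg_le n d (\<lambda>x. Poly_Mapping.lookup P m * (\<Prod>i\<in>Poly_Mapping.keys m. x i ^ Poly_Mapping.lookup m i))"
    if m: "m \<in> Poly_Mapping.keys P" for m
  proof -
    have "poly_deg_le n (monomial_degree m) (\<lambda>x::nat \<Rightarrow> 'a. \<Prod>i\<in>Poly_Mapping.keys m. x i ^ Poly_Mapping.lookup m i)"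
      unfolding monomial_degree_def using m assms(1) by (intro mono) (auto simp: polys_in_def)
    then have "poly_deg_le n d (\<lambda>x::nat \<Rightarrow> 'a. \<Prod>i\<in>Poly_Mapping.keys m. x i ^ Poly_Mapping.lookup m i)"
      using assms(2) m by (auto simp: total_degree_le_iff intro: poly_deg_le_mono)
    then show ?thesis by (rule poly_deg_le_scale)
  qed
  then have "poly_deg_le n d (\<lambda>x. poly_fun P x)"
    unfolding poly_fun_def by (rule poly_deg_le_sum)
  then show ?thesis by simp
qed

text \<open>The three rules are imitated by a constant polynomial, by raising one exponent in every
  monomial, and by addition. Only inclusions between sets of monomials are tracked, so cancellation
  does no harm.\<close>

lemma poly_deg_le_imp_poly_fun:
  "poly_deg_le n d p \<Longrightarrow> \<exists>P\<in>polys_in n. total_degree P \<le> d \<and> poly_fun P = p"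
proof (induction rule: poly_deg_le.induct)
  case (const d c)
  show ?case
    by (rule bexI[of _ "Poly_Mapping.single 0 c"])
       (auto simp: fun_eq_iff poly_fun_single polys_in_def total_degree_le_iff monomial_degree_def)
next
  case (var i d q)
  then obtain P where P: "P \<in> polys_in n" "total_degree P \<le> d" "poly_fun P = q" by blast
  define P' where "P' = (\<Sum>m\<in>Poly_Mapping.keys P.
     Poly_Mapping.single (m + Poly_Mapping.single i 1) (Poly_Mapping.lookup P m))"
  have "poly_fun P' a = a i * q a" for a
    unfolding P'_def poly_fun_sum poly_fun_single monomial_times_var P(3)[symmetric]
    unfolding poly_fun_def by (simp add: sum_distrib_left mult.left_commute)
  moreover have keys: "Poly_Mapping.keys P' \<subseteq> (\<lambda>m. m + Poly_Mapping.single i 1) ` Poly_Mapping.keys P"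
    unfolding P'_def by (rule subset_trans[OF Poly_Mapping.keys_sum]) auto
  have "P' \<in> polys_in n"
    unfolding polys_in_def
  proof clarify
    fix m j assume "m \<in> Poly_Mapping.keys P'" "j \<in> Poly_Mapping.keys m"
    then obtain m0 where m0: "m0 \<in> Poly_Mapping.keys P" "j \<in> Poly_Mapping.keys (m0 + Poly_Mapping.single i 1)"
      using keys by blast
    then have "j \<in> Poly_Mapping.keys m0 \<union> {i}"
      using Poly_Mapping.keys_add[of m0 "Poly_Mapping.single i 1"] by auto
    then show "j < n" using m0(1) P(1) var(1) by (auto simp: polys_in_def)
  qed
  moreover have "total_degree P' \<le> Suc d"
    unfolding total_degree_le_iff
  proof
    fix m assume "m \<in> Poly_Mapping.keys P'"
    then obtain m0 where "m0 \<in> Poly_Mapping.keys P" "m = m0 + Poly_Mapping.single i 1" using keys by blast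
    then show "monomial_degree m \<le> Suc d"
      using P(2) by (simp only: monomial_degree_times_var total_degree_le_iff Suc_le_mono)
  qed
  ultimately show ?case by (intro bexI[of _ P']) (auto simp: fun_eq_iff)
next
  case (add d p q)
  then obtain P Q where PQ: "P \<in> polys_in n" "total_degree P \<le> d" "poly_fun P = p"
    "Q \<in> polys_in n" "total_degree Q \<le> d" "poly_fun Q = q" by blast
  have "Poly_Mapping.keys (P + Q) \<subseteq> Poly_Mapping.keys P \<union> Poly_Mapping.keys Q" by (rule Poly_Mapping.keys_add)
  then show ?case using PQ
    by (intro bexI[of _ "P + Q"]) (force simp: fun_eq_iff poly_fun_add polys_in_def total_degree_le_iff)+
qed

lemma fun_degree_le:
  assumes "poly_deg_le n d p" "\<And>a. a \<in> points n \<Longrightarrow> p a = f a"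
  shows "fun_degree n f \<le> d"
proof -
  obtain P where P: "P \<in> polys_in n" "total_degree P \<le> d" "poly_fun P = p"
    using poly_deg_le_imp_poly_fun[OF assms(1)] by blast
  have "fun_degree n f \<le> total_degree P"
    unfolding fun_degree_def using P assms(2) by (intro Least_le) auto
  then show ?thesis using P by simp
qed

lemma poly_fun_cong:
  assumes "P \<in> polys_in n" "\<And>i. i < n \<Longrightarrow> a i = b i"
  shows "poly_fun P a = poly_fun P b"
proof -
  have "a i = b i" if "m \<in> Poly_Mapping.keys P" "i \<in> Poly_Mapping.keys m" for m i
    using assms that by (auto simp: polys_in_def)
  then show ?thesis unfolding poly_fun_def by simp
qed

text \<open>The least-degree representative is known to agree with \<open>f\<close> on
  \<open>points n\<close>. Both depend on the first \<open>n\<close> coordinates alone, so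
  restricting an argument to \<open>{..<n}\<close> extends the agreement to all arguments.\<close>

lemma poly_deg_le_fun_degree:
  assumes "f \<in> polys_in n"
  shows "poly_deg_le n (fun_degree n (poly_fun f)) (poly_fun f :: (nat \<Rightarrow> 'a::comm_ring_1) \<Rightarrow> 'a)"
proof -
  have "\<exists>P\<in>polys_in n. total_degree P = fun_degree n (poly_fun f) \<and> (\<forall>a\<in>points n. poly_fun P a = poly_fun f a)"
    unfolding fun_degree_def by (rule LeastI) (use assms in blast)
  then obtain P where P: "P \<in> polys_in n" "total_degree P = fun_degree n (poly_fun f)"
    "\<And>a. a \<in> points n \<Longrightarrow> poly_fun P a = poly_fun f a" by blast
  have "poly_fun P a = poly_fun f a" for a
  proof -
    have "poly_fun P a = poly_fun P (restrict a {..<n})" by (rule poly_fun_cong[OF P(1)]) simp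
    also have "\<dots> = poly_fun f (restrict a {..<n})" by (rule P(3)) (auto simp: points_def)
    also have "\<dots> = poly_fun f a" by (rule poly_fun_cong[OF assms]) simp
    finally show ?thesis .
  qed
  then have "poly_fun P = poly_fun f" by blast
  then show ?thesis using poly_deg_le_poly_fun[OF P(1), of "fun_degree n (poly_fun f)"] P(2) by simp
qed

text \<open>The threefold difference in the directions \<open>a\<close>, \<open>b\<close>,
  \<open>c\<close> at base point 0, written out so that its symmetry is visible.\<close>

definition third_difference :: "('v::ab_group_add \<Rightarrow> 'b::ab_group_add) \<Rightarrow> 'v \<Rightarrow> 'v \<Rightarrow> 'v \<Rightarrow> 'b" where
  "third_difference f a b c =
     f (a + b + c) - f (a + b) - f (a + c) - f (b + c) + f a + f b + f c - f 0"

text \<open>Three differences lower the degree from 3 to 0, so the threefold difference does not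
  depend on the base point.\<close>

lemma third_difference_eq_iterated:
  assumes "poly_deg_le n 3 f"
  shows "third_difference f a b c =
    ((f (x + a + b + c) - f (x + a + b)) - (f (x + a + c) - f (x + a))) -
    ((f (x + b + c) - f (x + b)) - (f (x + c) - f x))"
proof -
  let ?h = "\<lambda>x. ((f (x + a + b + c) - f (x + a + b)) - (f (x + a + c) - f (x + a))) -
    ((f (x + b + c) - f (x + b)) - (f (x + c) - f x))"
  have "poly_deg_le n 2 (\<lambda>x. f (x + c) - f x)"
    using poly_deg_le_difference[OF assms, of 2 c] by (simp only: numeral_3_eq_3 numeral_2_eq_2)
  then have "poly_deg_le n 1 (\<lambda>x. (f (x + b + c) - f (x + b)) - (f (x + c) - f x))"
    by (rule poly_deg_le_difference) simp
  then have "poly_deg_le n 0 ?h"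
    by (rule poly_deg_le_difference) simp
  then have "?h x = ?h 0" by (rule poly_deg_le_0) simp
  then show ?thesis by (simp only: third_difference_def add_0_left) (simp only: algebra_simps)
qed

text \<open>Differences telescope: a step by \<open>x'\<close> from 0 is followed by a step by
  \<open>x\<close> from \<open>x'\<close>, and the base point of the latter can be moved back to
  0.\<close>

lemma third_difference_add1:
  assumes "poly_deg_le n 3 f"
  shows "third_difference f (x + x') b c = third_difference f x b c + third_difference f x' b c"
  unfolding third_difference_eq_iterated[OF assms, of x b c x'] third_difference_def[of f x'] third_difference_def[of f "x + x'"]
  by (simp only: algebra_simps add_0_left)

lemma third_difference_sym12: "third_difference f a b c = third_difference f b a c"
  by (simp only: third_difference_def algebra_simps)

lemma third_difference_sym23: "third_difference f a b c = third_difference f a c b"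
  by (simp only: third_difference_def algebra_simps)

section \<open>Subspaces and cubic functions\<close>

text \<open>\<^const>\<open>points\<close> with the value \<open>0\<close> instead of \<^const>\<open>undefined\<close> outside \<open>{..<n}\<close>, which makes them a group.\<close>

definition vecs :: "nat \<Rightarrow> (nat \<Rightarrow> 'a::zero) set" where
  "vecs n = {x. \<forall>i\<ge>n. x i = 0}"

definition vscale :: "'a::comm_ring_1 \<Rightarrow> (nat \<Rightarrow> 'a) \<Rightarrow> (nat \<Rightarrow> 'a)" where
  "vscale c x = (\<lambda>i. c * x i)"

definition additive_on :: "'v::ab_group_add set \<Rightarrow> ('v \<Rightarrow> 'b::ab_group_add) \<Rightarrow> bool" where
  "additive_on G f \<longleftrightarrow> (\<forall>x\<in>G. \<forall>y\<in>G. f (x + y) = f x + f y)"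

lemma sum_fun_apply: "(\<Sum>j\<in>A. F j) i = (\<Sum>j\<in>A. F j i :: 'a::ab_group_add)"
  by (induction A rule: infinite_finite_induct) (auto simp: plus_fun_apply zero_fun_apply)

lemma vscale_apply: "vscale c x i = c * x i"
  by (simp add: vscale_def)

lemma vscale_add_left: "vscale (c + d) x = vscale c x + vscale d x"
  by (rule ext) (simp add: vscale_def distrib_right plus_fun_apply)

lemma vscale_diff_left: "vscale (c - d) x = vscale c x - vscale d x"
  by (rule ext) (simp add: vscale_def left_diff_distrib)

lemma vscale_vscale: "vscale c (vscale d x) = vscale (c * d) x"
  by (rule ext) (simp add: vscale_def mult.assoc)

lemma vscale_0: "vscale 0 x = 0"
  by (rule ext) (simp add: vscale_def zero_fun_apply)

lemma vscale_1: "vscale 1 x = x"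
  by (rule ext) (simp add: vscale_def)

lemma vecs_subgroup: "add_subgroup (vecs n :: (nat \<Rightarrow> 'a::ab_group_add) set)"
  by (simp add: add_subgroup_def vecs_def zero_fun_apply)

lemma bij_points_vecs:
  "bij_betw (\<lambda>x i. if i < n then x i else 0) (points n) (vecs n :: (nat \<Rightarrow> 'a::zero) set)"
  by (rule bij_betwI[where g = "\<lambda>x. restrict x {..<n}"])
     (auto simp: points_def vecs_def fun_eq_iff PiE_def extensional_def)

lemma finite_points: "finite (points n :: (nat \<Rightarrow> 'a::finite) set)"
  unfolding points_def by (intro finite_PiE) auto

lemma finite_vecs: "finite (vecs n :: (nat \<Rightarrow> 'a::{zero,finite}) set)"
  using bij_betw_finite[OF bij_points_vecs] finite_points by blast

text \<open>The additive group of a prime field is generated by 1. Consequently subgroups are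
  subspaces and additive functions are linear, which links the group arguments to linear
  algebra.\<close>

lemma mod_ring_eq_of_nat: "\<exists>k. (c :: 'p::prime_card mod_ring) = of_nat k"
proof -
  have "c = of_int (to_int_mod_ring c)" by (simp add: of_int_of_int_mod_ring)
  moreover have "to_int_mod_ring c \<ge> 0" using range_to_int_mod_ring[where 'a = 'p] by auto
  ultimately have "c = of_nat (nat (to_int_mod_ring c))" by (metis of_int_of_nat_eq int_nat_eq)
  then show ?thesis by blast
qed

lemma vscale_of_nat_in:
  assumes "add_subgroup H" "x \<in> H"
  shows "vscale (of_nat k) x \<in> H"
proof (induction k)
  case (Suc k)
  then show ?case using add_subgroup_add[OF assms(1) assms(2)] by (simp add: vscale_add_left vscale_1)
qed (simp add: vscale_0 add_subgroup_zero assms)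

lemma vscale_in:
  fixes H :: "(nat \<Rightarrow> 'p::prime_card mod_ring) set"
  assumes "add_subgroup H" "x \<in> H"
  shows "vscale c x \<in> H"
  using vscale_of_nat_in[OF assms] mod_ring_eq_of_nat[of c] by auto

lemma additive_on_add: "additive_on G f \<Longrightarrow> x \<in> G \<Longrightarrow> y \<in> G \<Longrightarrow> f (x + y) = f x + f y"
  by (simp add: additive_on_def)

lemma additive_on_zero: "additive_on G f \<Longrightarrow> add_subgroup G \<Longrightarrow> f 0 = 0"
  using additive_on_add[of G f 0 0] add_subgroup_zero[of G] by simp

lemma additive_on_vscale:
  fixes f :: "(nat \<Rightarrow> 'p::prime_card mod_ring) \<Rightarrow> 'p mod_ring"
  assumes f: "additive_on G f" and G: "add_subgroup G" and x: "x \<in> G"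
  shows "f (vscale c x) = c * f x"
proof -
  have "f (vscale (of_nat k) x) = of_nat k * f x" for k
  proof (induction k)
    case (Suc k)
    then show ?case
      using additive_on_add[OF f x vscale_of_nat_in[OF G x]]
      by (simp add: vscale_add_left vscale_1 distrib_right)
  qed (simp add: vscale_0 additive_on_zero[OF f G])
  then show ?thesis using mod_ring_eq_of_nat[of c] by auto
qed

section \<open>Coordinates, linear forms and quadratic functions\<close>

definition unit_vec :: "nat \<Rightarrow> nat \<Rightarrow> 'a::comm_ring_1" where
  "unit_vec k = (\<lambda>i. if i = k then 1 else 0)"

lemma vecs_mono: "k \<le> n \<Longrightarrow> vecs k \<subseteq> vecs n"
  by (auto simp: vecs_def)

lemma unit_vec_in: "k < n \<Longrightarrow> unit_vec k \<in> vecs n"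
  by (auto simp: vecs_def unit_vec_def)

lemma vecs_Suc_decompose:
  "x \<in> vecs (Suc k) \<Longrightarrow> x(k := 0) \<in> vecs k"
  "x = x(k := 0) + vscale (x k) (unit_vec k)"
  by (auto simp: vecs_def fun_eq_iff vscale_def unit_vec_def plus_fun_apply)

lemma vecs_0: "vecs 0 = {0 :: nat \<Rightarrow> 'a::zero}"
  by (auto simp: vecs_def fun_eq_iff zero_fun_apply)

lemma additive_on_vecs_linear_form:
  fixes f :: "(nat \<Rightarrow> 'p::prime_card mod_ring) \<Rightarrow> 'p mod_ring"
  assumes f: "additive_on (vecs n) f"
  shows "\<exists>l. linear_form n l \<and> (\<forall>x\<in>vecs n. l x = f x)"
proof -
  have "k \<le> n \<Longrightarrow> \<forall>x\<in>vecs k. f x = (\<Sum>i<k. f (unit_vec i) * x i)" for k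
  proof (induction k)
    case 0
    then show ?case using additive_on_zero[OF f vecs_subgroup] by (simp add: vecs_0)
  next
    case (Suc k)
    show ?case
    proof
      fix x :: "nat \<Rightarrow> 'p mod_ring" assume x: "x \<in> vecs (Suc k)"
      let ?x = "x(k := 0)"
      have mem: "?x \<in> vecs n" "unit_vec k \<in> vecs n"
        using vecs_Suc_decompose(1)[OF x] vecs_mono[of k n] unit_vec_in[of k n] Suc.prems by auto
      have "f x = f (?x + vscale (x k) (unit_vec k))" using vecs_Suc_decompose(2)[of x k] by simp
      also have "\<dots> = f ?x + x k * f (unit_vec k)"
        using additive_on_add[OF f mem(1) vscale_in[OF vecs_subgroup mem(2)]]
          additive_on_vscale[OF f vecs_subgroup mem(2)] by simp
      also have "f ?x = (\<Sum>i<k. f (unit_vec i) * ?x i)"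
        using Suc vecs_Suc_decompose(1)[OF x] by auto
      finally show "f x = (\<Sum>i<Suc k. f (unit_vec i) * x i)" by (simp add: mult.commute)
    qed
  qed
  from this[of n] show ?thesis
    by (intro exI[of _ "\<lambda>x. \<Sum>i<n. f (unit_vec i) * x i"]) (auto simp: linear_form_def)
qed

text \<open>In characteristic 2 the field is {0, 1}, on which every function is affine. Otherwise
  \<open>b / 2\<close> is the leading coefficient, and the formula follows by steps of 1.\<close>

lemma quadratic_one_variable:
  fixes f :: "'p::prime_card mod_ring \<Rightarrow> 'p mod_ring"
  assumes f: "\<And>s t. f (s + t) - f s - f t + f 0 = b * s * t"
  shows "\<exists>\<beta> \<gamma>. \<forall>t. f t = f 0 + t * \<beta> + t * t * \<gamma>"
proof (cases "(2 :: 'p mod_ring) = 0")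
  case True
  have "f t = f 0 + t * (f 1 - f 0) + t * t * 0" for t
  proof -
    obtain k where k: "t = of_nat k" using mod_ring_eq_of_nat by blast
    have "(of_nat k :: 'p mod_ring) = of_nat (2 * (k div 2) + k mod 2)" by simp
    also have "\<dots> = of_nat (k mod 2)" by (simp only: of_nat_add of_nat_mult of_nat_numeral True) simp
    finally have "(of_nat k :: 'p mod_ring) = of_nat (k mod 2)" .
    moreover have "k mod 2 = 0 \<or> k mod 2 = 1" by auto
    ultimately have "t = 0 \<or> t = 1" using k by auto
    then show ?thesis by auto
  qed
  then show ?thesis by blast
next
  case False
  define \<gamma> where "\<gamma> = b / 2"
  define \<beta> where "\<beta> = f 1 - f 0 - \<gamma>"
  have b: "b = \<gamma> + \<gamma>" using False by (simp add: \<gamma>_def field_simps)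
  have "f (of_nat k) = f 0 + of_nat k * \<beta> + of_nat k * of_nat k * \<gamma>" for k
  proof (induction k)
    case (Suc k)
    have "f (of_nat k + 1) = f (of_nat k) + f 1 - f 0 + b * of_nat k"
      using f[of "of_nat k" 1] by (simp add: algebra_simps)
    also have "\<dots> = f 0 + (of_nat k + 1) * \<beta> + (of_nat k + 1) * (of_nat k + 1) * \<gamma>"
      unfolding Suc b \<beta>_def by (simp add: algebra_simps)
    finally show ?case by (simp add: add.commute)
  qed simp
  then show ?thesis by (metis mod_ring_eq_of_nat)
qed

text \<open>The second difference \<open>B\<close> at 0 is symmetric and its defect of additivity is
  a third difference, so it is bilinear. The polynomial is built one coordinate at a time from the
  restriction of \<open>f\<close> to the new axis and a cross term given by \<open>B\<close>. As
  \<open>B\<close> is never halved on the whole space, characteristic 2 is included.\<close>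

lemma zero_third_difference_quadratic:
  fixes f :: "(nat \<Rightarrow> 'p::prime_card mod_ring) \<Rightarrow> 'p mod_ring"
  assumes f: "\<And>a b c. a \<in> vecs n \<Longrightarrow> b \<in> vecs n \<Longrightarrow> c \<in> vecs n \<Longrightarrow> third_difference f a b c = 0"
  shows "\<exists>q. poly_deg_le n 2 q \<and> (\<forall>x\<in>vecs n. q x = f x)"
proof -
  define B where "B a b = f (a + b) - f a - f b + f 0" for a b
  have B_sym: "B a b = B b a" for a b by (simp add: B_def add.commute)
  have B1: "B (a + a') b = B a b + B a' b" if "a \<in> vecs n" "a' \<in> vecs n" "b \<in> vecs n" for a a' b
  proof -
    have "B (a + a') b - B a b - B a' b = third_difference f a a' b"
      unfolding B_def third_difference_def by (simp only: algebra_simps)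
    then show ?thesis using f[OF that] by (simp add: algebra_simps)
  qed
  have B_scale: "B (vscale c a) b = c * B a b" if "a \<in> vecs n" "b \<in> vecs n" for a b c
    using additive_on_vscale[of "vecs n" "\<lambda>a. B a b" a c] vecs_subgroup that B1
    by (auto simp: additive_on_def)
  have "k \<le> n \<Longrightarrow> \<exists>q. poly_deg_le k 2 q \<and> (\<forall>x\<in>vecs k. q x = f x)" for k
  proof (induction k)
    case 0
    show ?case
      by (rule exI[of _ "\<lambda>x. f 0"]) (simp add: vecs_0 poly_deg_le.const)
  next
    case (Suc k)
    then obtain q where q: "poly_deg_le k 2 q" "\<And>x. x \<in> vecs k \<Longrightarrow> q x = f x" by auto
    let ?e = "unit_vec k :: nat \<Rightarrow> 'p mod_ring"
    have e: "?e \<in> vecs n" using unit_vec_in[of k n] Suc.prems by simp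
    have se: "vscale t ?e \<in> vecs n" for t by (rule vscale_in[OF vecs_subgroup e])
    have "f (vscale (s + t) ?e) - f (vscale s ?e) - f (vscale t ?e) + f (vscale 0 ?e) = B ?e ?e * s * t" for s t
    proof -
      have "B (vscale s ?e) (vscale t ?e) = s * (t * B ?e ?e)"
        using B_scale[OF e se] B_sym[of ?e "vscale t ?e"] B_scale[OF e e] by simp
      then show ?thesis by (simp add: B_def vscale_add_left vscale_0 mult_ac)
    qed
    from quadratic_one_variable[of "\<lambda>t. f (vscale t ?e)", OF this]
    obtain \<beta> \<gamma> where \<beta>\<gamma>: "\<And>t. f (vscale t ?e) = f 0 + t * \<beta> + t * t * \<gamma>"
      by (auto simp: vscale_0)
    have "additive_on (vecs n) (\<lambda>a. B a ?e)" using B1 e by (simp add: additive_on_def)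
    then have "additive_on (vecs k) (\<lambda>a. B a ?e)"
      using vecs_mono[of k n] Suc.prems unfolding additive_on_def by (auto simp: subset_iff)
    then obtain l where l: "linear_form k l" "\<And>x. x \<in> vecs k \<Longrightarrow> l x = B x ?e"
      using additive_on_vecs_linear_form by blast
    define q' where "q' = (\<lambda>x. q x + x k * (\<beta> + x k * \<gamma>) + x k * l x)"
    have "poly_deg_le (Suc k) 2 q'"
      unfolding q'_def numeral_2_eq_2
      using poly_deg_le_mono_vars[OF q(1), of "Suc k"] poly_deg_le_mono_vars[OF poly_deg_le_linear_form[OF l(1)], of "Suc k"]
      by (intro poly_deg_le.add poly_deg_le.var poly_deg_le.const) (auto simp: numeral_2_eq_2)
    moreover have "q' x = f x" if x: "x \<in> vecs (Suc k)" for x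
    proof -
      define y where "y = x(k := 0)"
      have x': "y \<in> vecs k" "y \<in> vecs n" using vecs_Suc_decompose(1)[OF x] y_def vecs_mono[of k n] Suc.prems by auto
      have "q x = q y" by (rule poly_deg_le_cong[OF q(1)]) (simp add: y_def)
      then have qx: "q x = f y" using q(2)[OF x'(1)] by simp
      have "l x = l y" using poly_deg_le_cong[OF poly_deg_le_linear_form[OF l(1)], of x y] by (simp add: y_def)
      then have lx: "l x = B y ?e" using l(2)[OF x'(1)] by simp
      have "f x = f (y + vscale (x k) ?e)" using vecs_Suc_decompose(2)[of x k] by (simp add: y_def)
      also have "\<dots> = B y (vscale (x k) ?e) + f y + f (vscale (x k) ?e) - f 0"
        by (simp add: B_def)
      also have "B y (vscale (x k) ?e) = x k * B y ?e"
        using B_scale[OF e x'(2)] B_sym[of y] by simp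
      finally show ?thesis by (simp add: q'_def qx lx \<beta>\<gamma> algebra_simps)
    qed
    ultimately show ?case by blast
  qed
  then show ?thesis by simp
qed

text \<open>\<open>H\<close> is enlarged by one line at a time until it fills \<open>K\<close>; each
  line at least doubles the cardinality, whence \<open>2 ^ c\<close>. The \<open>e j\<close> span
  \<open>K\<close> modulo \<open>H\<close>, and the \<open>l j\<close> give coefficients that depend
  additively on \<open>x\<close>.\<close>

lemma subgroup_complement:
  fixes K :: "(nat \<Rightarrow> 'p::prime_card mod_ring) set"
  assumes "add_subgroup H" "H \<subseteq> K" and K: "add_subgroup K" "finite K"
  shows "\<exists>c e l. 2 ^ c * card H \<le> card K \<and> (\<forall>j<c. e j \<in> K \<and> additive_on K (l j)) \<and>
     (\<forall>x\<in>K. x - (\<Sum>j<c. vscale (l j x) (e j)) \<in> H)"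
  using assms(1,2)
proof (induction "card K - card H" arbitrary: H rule: less_induct)
  case less
  show ?case
  proof (cases "H = K")
    case True
    then show ?thesis by (intro exI[of _ 0]) auto
  next
    case False
    then obtain v where v: "v \<in> K" "v \<notin> H" using less by blast
    define H' where "H' = {h + vscale t v | h t. h \<in> H}"
    have H': "add_subgroup H'"
      unfolding add_subgroup_def
    proof (intro conjI ballI)
      show "0 \<in> H'" unfolding H'_def using add_subgroup_zero[OF less(2)] by (force simp: vscale_0 intro: exI[of _ 0])
      fix x y assume "x \<in> H'" "y \<in> H'"
      then obtain h t h' t' where "h \<in> H" "h' \<in> H" "x = h + vscale t v" "y = h' + vscale t' v"
        by (auto simp: H'_def)
      then have "x - y = (h - h') + vscale (t - t') v" "h - h' \<in> H"
        using add_subgroup_diff[OF less(2)] by (simp_all add: vscale_diff_left)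
      then show "x - y \<in> H'" unfolding H'_def by blast
    qed
    have sub: "H \<subseteq> H'" unfolding H'_def by (force simp: vscale_0 intro: exI[of _ 0])
    have "v \<in> H'" unfolding H'_def
      using add_subgroup_zero[OF less(2)] vscale_1[of v] by (metis (mono_tags, lifting) add_0_left mem_Collect_eq)
    then have "H \<subset> H'" using sub v by blast
    have H'K: "H' \<subseteq> K" unfolding H'_def
      using less(3) v vscale_in[OF K(1)] add_subgroup_add[OF K(1)] by auto
    have finH': "finite H'" using H'K K finite_subset by blast
    have card: "2 * card H \<le> card H'" by (rule proper_subgroup_card[OF less(2) H' \<open>H \<subset> H'\<close> finH'])
    have "card H < card H'" using psubset_card_mono[OF finH' \<open>H \<subset> H'\<close>] .
    moreover have "card H' \<le> card K" using card_mono[OF K(2) H'K] .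
    ultimately have "card K - card H' < card K - card H" by simp
    from less(1)[OF this H' H'K]
    obtain c e l where IH: "2 ^ c * card H' \<le> card K"
      "\<And>j. j < c \<Longrightarrow> e j \<in> K \<and> additive_on K (l j)"
      "\<And>x. x \<in> K \<Longrightarrow> x - (\<Sum>j<c. vscale (l j x) (e j)) \<in> H'"
      by blast
    \<comment> \<open>By the induction hypothesis \<open>\<pi>\<close> maps \<open>K\<close> into
      \<open>H'\<close>. The missing functional is the coordinate along \<open>v\<close> modulo
      \<open>H\<close>, taken after \<open>\<pi>\<close>.\<close>
    define \<pi> where "\<pi> x = x - (\<Sum>j<c. vscale (l j x) (e j))" for x
    have \<pi>_add: "\<pi> (x + y) = \<pi> x + \<pi> y" if "x \<in> K" "y \<in> K" for x y
      using IH(2) that by (simp add: \<pi>_def additive_on_def vscale_add_left sum.distrib)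
    \<comment> \<open>Two different coordinates would put a nonzero multiple of \<open>v\<close>,
      and hence \<open>v\<close> itself, into \<open>H\<close>. This uniqueness makes the arbitrary
      choice in \<open>\<tau>\<close> additive.\<close>
    have uniq: "s = t" if "y - vscale s v \<in> H" "y - vscale t v \<in> H" for s t y
    proof (rule ccontr)
      assume "s \<noteq> t"
      have "vscale (s - t) v \<in> H"
        using add_subgroup_diff[OF less(2) that(2,1)] by (simp add: vscale_diff_left)
      then have "vscale (1 / (s - t)) (vscale (s - t) v) \<in> H" by (rule vscale_in[OF less(2)])
      then show False using v \<open>s \<noteq> t\<close> by (simp add: vscale_vscale vscale_1)
    qed
    define \<tau> where "\<tau> y = (SOME t. y - vscale t v \<in> H)" for y
    have \<tau>: "y - vscale (\<tau> y) v \<in> H" if y: "y \<in> H'" for y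
    proof -
      obtain h t where ht: "h \<in> H" "y = h + vscale t v" using y unfolding H'_def by blast
      have "y - vscale t v = h" unfolding ht(2) by (rule add_diff_cancel_right')
      then have "\<exists>t. y - vscale t v \<in> H" using ht(1) by metis
      then show ?thesis unfolding \<tau>_def by (rule someI_ex)
    qed
    have \<tau>_add: "\<tau> (x + y) = \<tau> x + \<tau> y" if "x \<in> H'" "y \<in> H'" for x y
    proof (rule uniq)
      show "x + y - vscale (\<tau> (x + y)) v \<in> H" using \<tau> add_subgroup_add[OF H'] that by blast
      have "(x - vscale (\<tau> x) v) + (y - vscale (\<tau> y) v) \<in> H"
        using add_subgroup_add[OF less(2)] \<tau> that by blast
      then show "x + y - vscale (\<tau> x + \<tau> y) v \<in> H" by (simp add: vscale_add_left algebra_simps)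
    qed
    define l' where "l' j = (if j < c then l j else (\<lambda>x. \<tau> (\<pi> x)))" for j
    define e' where "e' j = (if j < c then e j else v)" for j
    have \<pi>H': "\<pi> x \<in> H'" if "x \<in> K" for x using IH(3)[OF that] by (simp add: \<pi>_def)
    have "2 ^ Suc c * card H = 2 ^ c * (2 * card H)" by simp
    also have "\<dots> \<le> card K" using card IH(1) by (meson le_trans mult_le_mono2)
    finally have "2 ^ Suc c * card H \<le> card K" .
    moreover have "e' j \<in> K \<and> additive_on K (l' j)" if "j < Suc c" for j
      using IH(2) v \<pi>_add \<tau>_add \<pi>H' by (auto simp: e'_def l'_def additive_on_def)
    moreover have "x - (\<Sum>j<Suc c. vscale (l' j x) (e' j)) \<in> H" if "x \<in> K" for x
    proof -
      have "(\<Sum>j<Suc c. vscale (l' j x) (e' j)) = (\<Sum>j<c. vscale (l j x) (e j)) + vscale (\<tau> (\<pi> x)) v"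
        by (simp add: l'_def e'_def)
      then have "x - (\<Sum>j<Suc c. vscale (l' j x) (e' j)) = \<pi> x - vscale (\<tau> (\<pi> x)) v"
        by (simp add: \<pi>_def algebra_simps)
      then show ?thesis using \<tau>[OF \<pi>H'[OF that]] by simp
    qed
    ultimately show ?thesis by blast
  qed
qed

text \<open>The argument corrected by the first \<open>c\<close> forms is corrected by the next one,
  at the cost of a multiple of that form. All forms are evaluated at the original \<open>x\<close>,
  which is why the divided difference allows a general substitution \<open>A\<close>.\<close>

lemma split_off_linear_forms:
  fixes c :: nat
  assumes p: "poly_deg_le n (Suc d) p" and l: "\<And>j. j < c \<Longrightarrow> linear_form n (l j)"
  shows "\<exists>q. (\<forall>j<c. poly_deg_le n d (q j)) \<and>
    (\<forall>x. p x = (\<Sum>j<c. l j x * q j x) + p (\<lambda>i. x i - (\<Sum>j<c. l j x * e j i)))"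
  using l
proof (induction c)
  case 0
  then show ?case by simp
next
  case (Suc c)
  define A where "A = (\<lambda>x i. x i - (\<Sum>j<c. l j x * e j i))"
  have "\<And>j. j < c \<Longrightarrow> linear_form n (l j)" using Suc.prems by simp
  from Suc.IH[OF this] obtain q where q: "\<And>j. j < c \<Longrightarrow> poly_deg_le n d (q j)"
    "\<And>x. p x = (\<Sum>j<c. l j x * q j x) + p (A x)"
    unfolding A_def by blast
  have "linear_form n (\<lambda>x. A x i)" if "i < n" for i
    unfolding A_def using that Suc.prems
    by (intro linear_form_diff linear_form_sum linear_form_mult_right linear_form_var) auto
  then obtain r where r: "poly_deg_le n d r"
    "\<And>x. p (A x) - p (\<lambda>i. A x i - l c x * e c i) = l c x * r x"
    using poly_deg_le_divided_difference[OF Suc.prems[of c], of n A "Suc d" p "e c"] p by auto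
  have "(\<lambda>i. A x i - l c x * e c i) = (\<lambda>i. x i - (\<Sum>j<Suc c. l j x * e j i))" for x
    by (rule ext) (simp add: A_def)
  then have *: "p (A x) = l c x * r x + p (\<lambda>i. x i - (\<Sum>j<Suc c. l j x * e j i))" for x
    using r(2)[of x] by (simp add: algebra_simps)
  define q' where "q' j = (if j < c then q j else r)" for j
  have "p x = (\<Sum>j<Suc c. l j x * q' j x) + p (\<lambda>i. x i - (\<Sum>j<Suc c. l j x * e j i))" for x
    unfolding q(2)[of x] * by (simp add: q'_def)
  moreover have "\<forall>j<Suc c. poly_deg_le n d (q' j)" using q(1) r(1) by (simp add: q'_def)
  ultimately show ?case by blast
qed

lemma additive_on_vecs_linear_forms:
  fixes a :: "nat \<Rightarrow> (nat \<Rightarrow> 'p::prime_card mod_ring) \<Rightarrow> 'p mod_ring"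
  assumes "\<And>j. j < c \<Longrightarrow> additive_on (vecs n) (a j)"
  obtains l where "\<And>j. j < c \<Longrightarrow> linear_form n (l j)"
    "\<And>j x. j < c \<Longrightarrow> x \<in> vecs n \<Longrightarrow> l j x = a j x"
proof -
  have "\<forall>j. \<exists>l. j < c \<longrightarrow> linear_form n l \<and> (\<forall>x\<in>vecs n. l x = a j x)"
    using additive_on_vecs_linear_form[OF assms] by blast
  from choice[OF this] show ?thesis using that by blast
qed

lemma vscale_sum_apply: "(\<Sum>j\<in>J. vscale (a j) (e j)) i = (\<Sum>j\<in>J. a j * e j i)"
  by (simp add: sum_fun_apply vscale_apply)

text \<open>\<open>\<pi>\<close> moves a vector into \<open>K\<close> along \<open>c1\<close>
  directions, and \<open>\<rho>\<close> replaces an element of \<open>K\<close> by a combination of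
  \<open>c2\<close> vectors that is congruent to it modulo \<open>K \<inter> V\<close>. The products
  come from passing from \<open>f x\<close> to \<open>f (\<pi> x)\<close>, the function
  \<open>g\<close> is \<open>f\<close> after \<open>\<rho>\<close>, and \<open>r\<close> is the
  difference of the two restrictions.\<close>

lemma cubic_structure:
  fixes f :: "(nat \<Rightarrow> 'p::prime_card mod_ring) \<Rightarrow> 'p mod_ring"
  assumes f: "poly_deg_le n 3 f"
    and K: "add_subgroup K" "K \<subseteq> vecs n" and V: "add_subgroup V" "V \<subseteq> vecs n"
    and zero: "\<And>x y z. x \<in> V \<Longrightarrow> y \<in> K \<Longrightarrow> z \<in> K \<Longrightarrow> third_difference f x y z = 0"
  shows "\<exists>c\<^sub>1 c\<^sub>2 l q r l' g.
    2 ^ c\<^sub>1 * card K \<le> card (vecs n :: (nat \<Rightarrow> 'p mod_ring) set) \<and>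
    2 ^ c\<^sub>2 * card V \<le> card (vecs n :: (nat \<Rightarrow> 'p mod_ring) set) \<and>
    (\<forall>j<c\<^sub>1. linear_form n (l j) \<and> poly_deg_le n 2 (q j)) \<and> poly_deg_le n 2 r \<and>
    (\<forall>j<c\<^sub>2. linear_form n (l' j)) \<and> poly_deg_le c\<^sub>2 3 g \<and>
    (\<forall>x\<in>vecs n. f x = (\<Sum>j<c\<^sub>1. l j x * q j x) + r x + g (\<lambda>j. l' j x))"
proof -
  let ?E = "vecs n :: (nat \<Rightarrow> 'p mod_ring) set"
  define T where "T = third_difference f"
  interpret symmetric_trilinear ?E T
    by standard (auto simp: T_def vecs_subgroup finite_vecs third_difference_add1[OF f]
        intro: third_difference_sym12 third_difference_sym23)
  have finK: "finite K" using K finite_vecs finite_subset by blast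
  have K0: "add_subgroup (K \<inter> V)" using K V add_subgroup_Int by blast

  obtain c1 e l0 where c1: "2 ^ c1 * card K \<le> card ?E"
    and e: "\<And>j. j < c1 \<Longrightarrow> additive_on ?E (l0 j)"
    and l0: "\<And>x. x \<in> ?E \<Longrightarrow> x - (\<Sum>j<c1. vscale (l0 j x) (e j)) \<in> K"
    using subgroup_complement[OF K vecs_subgroup finite_vecs] by blast
  obtain l where l: "\<And>j. j < c1 \<Longrightarrow> linear_form n (l j)"
    "\<And>j x. j < c1 \<Longrightarrow> x \<in> ?E \<Longrightarrow> l j x = l0 j x"
    using additive_on_vecs_linear_forms[of c1 n l0] e by blast
  define \<pi> where "\<pi> x = x - (\<Sum>j<c1. vscale (l0 j x) (e j))" for x
  have \<pi>K: "\<pi> x \<in> K" if "x \<in> ?E" for x using l0[OF that] by (simp only: \<pi>_def)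
  have \<pi>_add: "\<pi> (x + y) = \<pi> x + \<pi> y" if "x \<in> ?E" "y \<in> ?E" for x y
    using e that by (simp add: \<pi>_def additive_on_def vscale_add_left sum.distrib)

  obtain c2 w m0 where c2: "2 ^ c2 * card (K \<inter> V) \<le> card K"
    and w: "\<And>j. j < c2 \<Longrightarrow> w j \<in> K \<and> additive_on K (m0 j)"
    and m0: "\<And>x. x \<in> K \<Longrightarrow> x - (\<Sum>j<c2. vscale (m0 j x) (w j)) \<in> K \<inter> V"
    using subgroup_complement[OF K0 Int_lower1 K(1) finK] by blast
  define \<rho> where "\<rho> x = (\<Sum>j<c2. vscale (m0 j x) (w j))" for x
  have \<rho>K: "\<rho> x \<in> K" for x
    unfolding \<rho>_def using w K by (intro add_subgroup_sum vscale_in) auto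
  have \<rho>_add: "\<rho> (x + y) = \<rho> x + \<rho> y" if "x \<in> K" "y \<in> K" for x y
    using w that by (simp add: \<rho>_def additive_on_def vscale_add_left sum.distrib)

  have m0\<pi>: "additive_on ?E (\<lambda>x. m0 j (\<pi> x))" if "j < c2" for j
    using w[OF that] \<pi>K by (auto simp: additive_on_def \<pi>_add)
  obtain l' where l': "\<And>j. j < c2 \<Longrightarrow> linear_form n (l' j)"
    "\<And>j x. j < c2 \<Longrightarrow> x \<in> ?E \<Longrightarrow> l' j x = m0 j (\<pi> x)"
    using additive_on_vecs_linear_forms[of c2 n "\<lambda>j x. m0 j (\<pi> x)"] m0\<pi> by blast
  \<comment> \<open>\<open>f\<close> on the span of the \<open>w j\<close>, in terms of the
    coefficients.\<close>
  define g where "g t = f (\<lambda>i. \<Sum>j<c2. t j * w j i)" for t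
  have g: "poly_deg_le c2 3 g"
    unfolding g_def
    by (intro poly_deg_le_compose[OF f] linear_form_sum linear_form_mult_right linear_form_var) auto
  have g_eq: "g (\<lambda>j. l' j x) = f (\<rho> (\<pi> x))" if "x \<in> ?E" for x
  proof -
    have "\<rho> (\<pi> x) = (\<lambda>i. \<Sum>j<c2. l' j x * w j i)"
      using l'(2) that by (intro ext) (simp add: \<rho>_def vscale_sum_apply)
    then show ?thesis by (simp only: g_def)
  qed

  \<comment> \<open>The arguments are replaced one by one, each moved to the first slot by symmetry;
    the error lies in \<open>V \<times> K \<times> K\<close>, where \<open>T\<close>
    vanishes.\<close>
  have "T y1 y2 y3 = T (\<rho> y1) (\<rho> y2) (\<rho> y3)" if y: "y1 \<in> K" "y2 \<in> K" "y3 \<in> K" for y1 y2 y3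
  proof -
    have V: "y - \<rho> y \<in> V" if "y \<in> K" for y using m0[OF that] by (simp add: \<rho>_def)
    have "T y1 y2 y3 = T (y1 - \<rho> y1) y2 y3 + T (\<rho> y1) y2 y3" by (simp add: diff1)
    also have "T (y1 - \<rho> y1) y2 y3 = 0" unfolding T_def by (rule zero[OF V[OF y(1)] y(2,3)])
    also have "T (\<rho> y1) y2 y3 = T (y2 - \<rho> y2) (\<rho> y1) y3 + T (\<rho> y2) (\<rho> y1) y3"
      by (simp add: diff1 sym12[of y2 "\<rho> y1"])
    also have "T (y2 - \<rho> y2) (\<rho> y1) y3 = 0" unfolding T_def by (rule zero[OF V[OF y(2)] \<rho>K y(3)])
    also have "T (\<rho> y2) (\<rho> y1) y3 = T y3 (\<rho> y2) (\<rho> y1)"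
      by (simp only: sym12[of y3] sym23[of "\<rho> y2" y3])
    also have "\<dots> = T (y3 - \<rho> y3) (\<rho> y2) (\<rho> y1) + T (\<rho> y3) (\<rho> y2) (\<rho> y1)" by (simp add: diff1)
    also have "T (y3 - \<rho> y3) (\<rho> y2) (\<rho> y1) = 0" unfolding T_def by (rule zero[OF V[OF y(3)] \<rho>K \<rho>K])
    also have "T (\<rho> y3) (\<rho> y2) (\<rho> y1) = T (\<rho> y1) (\<rho> y2) (\<rho> y3)"
      by (metis sym12 sym23)
    finally show ?thesis by simp
  qed
  note T_\<rho> = this
  define \<Phi> where "\<Phi> x = f (\<pi> x) - f (\<rho> (\<pi> x))" for x
  \<comment> \<open>Third differences pass through the additive maps \<open>\<pi>\<close> and
    \<open>\<rho>\<close>, so both parts of \<open>\<Phi>\<close> have the same one.\<close>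
  have "third_difference \<Phi> a b c = 0" if abc: "a \<in> ?E" "b \<in> ?E" "c \<in> ?E" for a b c
  proof -
    have sums: "a + b \<in> ?E" using abc add_subgroup_add[OF vecs_subgroup] by blast
    have "0 \<in> ?E" by (rule add_subgroup_zero[OF vecs_subgroup])
    then have \<pi>0: "\<pi> 0 = 0" using \<pi>_add[of 0 0] by simp
    have \<rho>0: "\<rho> 0 = 0"
      using \<rho>_add[of 0 0] add_subgroup_zero[OF K(1)] by simp
    have KK: "\<pi> a + \<pi> b \<in> K" using \<pi>K abc add_subgroup_add[OF K(1)] by blast
    have "third_difference \<Phi> a b c = T (\<pi> a) (\<pi> b) (\<pi> c) - T (\<rho> (\<pi> a)) (\<rho> (\<pi> b)) (\<rho> (\<pi> c))"
      by (simp only: T_def third_difference_def \<Phi>_def \<pi>_add[OF sums abc(3)] \<pi>_add[OF abc(1,2)]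
          \<pi>_add[OF abc(1,3)] \<pi>_add[OF abc(2,3)] \<rho>_add[OF KK \<pi>K[OF abc(3)]]
          \<rho>_add[OF \<pi>K[OF abc(1)] \<pi>K[OF abc(2)]] \<rho>_add[OF \<pi>K[OF abc(1)] \<pi>K[OF abc(3)]]
          \<rho>_add[OF \<pi>K[OF abc(2)] \<pi>K[OF abc(3)]] \<pi>0 \<rho>0)
        (simp only: algebra_simps)
    then show ?thesis using T_\<rho>[OF \<pi>K[OF abc(1)] \<pi>K[OF abc(2)] \<pi>K[OF abc(3)]] by simp
  qed
  then obtain r where r: "poly_deg_le n 2 r" "\<And>x. x \<in> ?E \<Longrightarrow> r x = \<Phi> x"
    using zero_third_difference_quadratic by blast

  obtain q where q: "\<And>j. j < c1 \<Longrightarrow> poly_deg_le n 2 (q j)"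
    "\<And>x. f x = (\<Sum>j<c1. l j x * q j x) + f (\<lambda>i. x i - (\<Sum>j<c1. l j x * e j i))"
    using split_off_linear_forms[of n 2 f c1 l e] f l(1) by (auto simp: numeral_3_eq_3 numeral_2_eq_2)
  have "f x = (\<Sum>j<c1. l j x * q j x) + r x + g (\<lambda>j. l' j x)" if x: "x \<in> ?E" for x
  proof -
    have "\<pi> x = (\<lambda>i. x i - (\<Sum>j<c1. l j x * e j i))"
      using l(2)[OF _ x] by (intro ext) (simp add: \<pi>_def vscale_sum_apply)
    then have "f x = (\<Sum>j<c1. l j x * q j x) + f (\<pi> x)" using q(2)[of x] by (simp only:)
    also have "f (\<pi> x) = r x + f (\<rho> (\<pi> x))" using r(2)[OF x] by (simp add: \<Phi>_def)
    finally show ?thesis using g_eq[OF x] by (simp add: add.assoc)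
  qed
  \<comment> \<open>The index of \<open>K \<inter> V\<close> in \<open>K\<close> is at most the
    index of \<open>V\<close> in the whole space.\<close>
  moreover have "2 ^ c2 * card V \<le> card ?E"
  proof -
    have "card K * card V \<le> card ?E * card (K \<inter> V)"
      by (rule card_mult_le_card_Int) (use K V finite_vecs vecs_subgroup in auto)
    have "card (K \<inter> V) * (2 ^ c2 * card V) = (2 ^ c2 * card (K \<inter> V)) * card V" by simp
    also have "\<dots> \<le> card K * card V" using c2 by (rule mult_right_mono) simp
    also have "\<dots> \<le> card ?E * card (K \<inter> V)" by fact
    finally have "card (K \<inter> V) * (2 ^ c2 * card V) \<le> card (K \<inter> V) * card ?E" by (simp only: mult.commute)
    then show ?thesis using add_subgroup_card_pos[OF K0] finK by simp
  qed
  ultimately show ?thesis using c1 l(1) q(1) r(1) l'(1) g by blast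
qed

section \<open>Character sums\<close>

definition additive_char :: "'p::prime_card mod_ring \<Rightarrow> complex" where
  "additive_char t = cis (2 * pi * real_of_int (to_int_mod_ring t) / real CARD('p))"

lemma to_int_mod_ring_bounds:
  "0 \<le> to_int_mod_ring (t :: 'p::finite mod_ring)" "to_int_mod_ring t < int CARD('p)"
  using range_to_int_mod_ring[where 'a = 'p] by (auto simp: set_eq_iff image_iff)

lemma cis_mod:
  assumes "p > 0"
  shows "cis (2 * pi * real_of_int (k mod int p) / real p) = cis (2 * pi * real_of_int k / real p)"
proof -
  have "k = k mod int p + int p * (k div int p)" by simp
  then have "real_of_int k = real_of_int (k mod int p) + real p * real_of_int (k div int p)"
    by (metis of_int_add of_int_mult of_int_of_nat_eq)
  then have "2 * pi * real_of_int k / real p =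
      2 * pi * real_of_int (k mod int p) / real p + 2 * pi * real_of_int (k div int p)"
    using assms by (simp add: field_simps)
  then show ?thesis by (simp add: cis_mult[symmetric] cis_multiple_2pi)
qed

lemma additive_char_add: "additive_char (s + t) = additive_char s * additive_char t"
  for s t :: "'p::prime_card mod_ring"
  by (simp add: additive_char_def to_int_mod_ring_add cis_mod cis_mult distrib_left add_divide_distrib)

lemma norm_additive_char [simp]: "norm (additive_char t) = 1"
  by (simp add: additive_char_def)

lemma additive_char_0 [simp]: "additive_char 0 = 1"
  by (simp add: additive_char_def)

lemma additive_char_diff: "additive_char (s - t) = additive_char s * cnj (additive_char t)"
proof -
  have "additive_char (s - t) * additive_char t * cnj (additive_char t) = additive_char s * cnj (additive_char t)"
    by (simp add: additive_char_add[symmetric])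
  moreover have "additive_char t * cnj (additive_char t) = 1"
    by (simp add: complex_norm_square[symmetric])
  ultimately show ?thesis by (simp add: mult.assoc)
qed

text \<open>The angle is a multiple of \<open>2 * pi\<close>, but the representative of
  \<open>t\<close> is smaller than \<open>p\<close>, which leaves only 0.\<close>

lemma additive_char_eq_1:
  fixes t :: "'p::prime_card mod_ring"
  assumes "additive_char t = 1"
  shows "t = 0"
proof -
  let ?k = "to_int_mod_ring t" and ?p = "real CARD('p)"
  have p: "?p > 0" by simp
  have "cos (2 * pi * real_of_int ?k / ?p) = 1"
    using assms by (simp add: additive_char_def complex_eq_iff)
  then obtain m :: int where "2 * pi * real_of_int ?k / ?p = m * 2 * pi"
    by (auto simp: cos_one_2pi_int)
  then have "real_of_int ?k = real_of_int m * ?p" using p by (simp add: field_simps)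
  then have k: "?k = m * int CARD('p)" by (metis of_int_eq_iff of_int_mult of_int_of_nat_eq)
  have "m * int CARD('p) < 1 * int CARD('p)" "0 \<le> m * int CARD('p)"
    using to_int_mod_ring_bounds[of t] k by auto
  then have "m = 0" by (auto simp: zero_le_mult_iff)
  then have "to_int_mod_ring t = to_int_mod_ring (0 :: 'p mod_ring)" using k by simp
  then show ?thesis by (metis of_int_mod_ring_to_int_mod_ring)
qed

section \<open>Cancellation and differencing of character sums\<close>

lemma sum_translate:
  assumes "add_subgroup G" "h \<in> G"
  shows "(\<Sum>x\<in>G. F (x + h)) = (\<Sum>x\<in>G. F x)"
proof -
  have "bij_betw (\<lambda>x. x + h) G G"
    by (rule bij_betw_byWitness[where f' = "\<lambda>x. x - h"])
       (use assms in \<open>auto intro: add_subgroup_add add_subgroup_diff\<close>)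
  then show ?thesis by (rule sum.reindex_bij_betw)
qed

definition char_sum :: "'v set \<Rightarrow> ('v \<Rightarrow> 'p::prime_card mod_ring) \<Rightarrow> complex" where
  "char_sum G F = (\<Sum>x\<in>G. additive_char (F x))"

text \<open>Translation by \<open>h\<close> preserves the sum and also multiplies it by
  \<open>additive_char (F h)\<close>, which differs from 1.\<close>

lemma char_sum_additive_eq_0:
  assumes G: "add_subgroup G" and F: "additive_on G F" and h: "h \<in> G" "F h \<noteq> 0"
  shows "char_sum G F = 0"
proof -
  have "char_sum G F = (\<Sum>x\<in>G. additive_char (F (x + h)))"
    unfolding char_sum_def by (rule sum_translate[OF G h(1), symmetric])
  also have "\<dots> = char_sum G F * additive_char (F h)"
    using F h(1) by (simp add: additive_on_def additive_char_add char_sum_def sum_distrib_right)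
  finally have "char_sum G F * (additive_char (F h) - 1) = 0" by (simp add: algebra_simps)
  then show ?thesis using additive_char_eq_1[of "F h"] h(2) by auto
qed

text \<open>Weyl differencing: the squared modulus is a double sum over \<open>x\<close> and
  \<open>y\<close>, reparametrised by \<open>h = x - y\<close>.\<close>

lemma norm_char_sum_power2_le:
  assumes G: "add_subgroup G"
  shows "(norm (char_sum G F))\<^sup>2 \<le> (\<Sum>h\<in>G. norm (char_sum G (\<lambda>x. F (x + h) - F x)))"
proof -
  have "complex_of_real ((norm (char_sum G F))\<^sup>2) = char_sum G F * cnj (char_sum G F)"
    by (rule complex_norm_square)
  also have "\<dots> = (\<Sum>y\<in>G. \<Sum>x\<in>G. additive_char (F x - F y))"
    unfolding char_sum_def cnj_sum sum_product by (subst sum.swap) (simp add: additive_char_diff)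
  also have "\<dots> = (\<Sum>y\<in>G. \<Sum>h\<in>G. additive_char (F (y + h) - F y))"
  proof (rule sum.cong[OF refl])
    fix y assume "y \<in> G"
    from sum_translate[OF G this, of "\<lambda>x. additive_char (F x - F y)"]
    show "(\<Sum>x\<in>G. additive_char (F x - F y)) = (\<Sum>h\<in>G. additive_char (F (y + h) - F y))"
      by (simp add: add.commute)
  qed
  also have "\<dots> = (\<Sum>h\<in>G. char_sum G (\<lambda>x. F (x + h) - F x))"
    unfolding char_sum_def by (rule sum.swap)
  finally have "(norm (char_sum G F))\<^sup>2 = norm (\<Sum>h\<in>G. char_sum G (\<lambda>x. F (x + h) - F x))"
    by (metis norm_of_real abs_power2 real_norm_def)
  also have "\<dots> \<le> (\<Sum>h\<in>G. norm (char_sum G (\<lambda>x. F (x + h) - F x)))" by (rule norm_sum)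
  finally show ?thesis .
qed

text \<open>After two differencings the exponent is a constant plus the additive function
  \<open>T h k\<close>. Its sum vanishes unless \<open>k\<close> lies in the radical of
  \<open>T h\<close>, and is at most \<open>card E\<close> in that case. Cauchy--Schwarz over
  \<open>h\<close> connects the two differencings.\<close>

lemma cubic_bias_le_radicals:
  fixes f :: "(nat \<Rightarrow> 'p::prime_card mod_ring) \<Rightarrow> 'p mod_ring"
  assumes f: "poly_deg_le n 3 f"
  defines "E \<equiv> vecs n" and "T \<equiv> third_difference f"
  shows "norm (char_sum E f) ^ 4 \<le>
    (real (card E))\<^sup>2 * (\<Sum>h\<in>E. real (card (symmetric_trilinear.rad T E h)))"
proof -
  interpret symmetric_trilinear E T
    unfolding E_def T_def
    by standard (auto simp: vecs_subgroup finite_vecs third_difference_add1[OF f]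
        intro: third_difference_sym12 third_difference_sym23)
  let ?D = "\<lambda>h x. f (x + h) - f x"
  have DD: "norm (char_sum E (\<lambda>x. ?D h (x + k) - ?D h x)) \<le> (if k \<in> rad E h then real (card E) else 0)"
    if hk: "h \<in> E" "k \<in> E" for h k
  proof -
    define c where "c = ?D h (0 + k) - ?D h 0"
    have "?D h (x + k) - ?D h x = c + T h k x" for x
      unfolding c_def T_def third_difference_def by (simp only: algebra_simps add_0_left)
    then have "char_sum E (\<lambda>x. ?D h (x + k) - ?D h x) = additive_char c * char_sum E (T h k)"
      by (simp add: char_sum_def additive_char_add sum_distrib_left)
    then have eq: "norm (char_sum E (\<lambda>x. ?D h (x + k) - ?D h x)) = norm (char_sum E (T h k))"
      by (simp add: norm_mult)
    show ?thesis
    proof (cases "k \<in> rad E h")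
      case True
      have "norm (char_sum E (T h k)) \<le> (\<Sum>x\<in>E. 1)"
        unfolding char_sum_def by (rule order_trans[OF norm_sum]) simp
      then show ?thesis using eq True by simp
    next
      case False
      then obtain x where "x \<in> E" "T h k x \<noteq> 0" using hk by (auto simp: rad_def)
      moreover have "additive_on E (T h k)" by (simp add: additive_on_def add3)
      ultimately have "char_sum E (T h k) = 0" by (intro char_sum_additive_eq_0[OF G])
      then show ?thesis using eq False by simp
    qed
  qed
  have rad: "(norm (char_sum E (?D h)))\<^sup>2 \<le> real (card E) * real (card (rad E h))" if h: "h \<in> E" for h
  proof -
    have "(norm (char_sum E (?D h)))\<^sup>2 \<le> (\<Sum>k\<in>E. norm (char_sum E (\<lambda>x. ?D h (x + k) - ?D h x)))"
      by (rule norm_char_sum_power2_le[OF G])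
    also have "\<dots> \<le> (\<Sum>k\<in>E. if k \<in> rad E h then real (card E) else 0)"
      using DD h by (intro sum_mono) auto
    also have "\<dots> = (\<Sum>k\<in>rad E h. real (card E))"
      using finite_G rad_subset[of E h] by (intro sum.mono_neutral_cong_right) auto
    finally show ?thesis by (simp add: mult.commute)
  qed
  have "norm (char_sum E f) ^ 4 = ((norm (char_sum E f))\<^sup>2)\<^sup>2" by simp
  also have "\<dots> \<le> (\<Sum>h\<in>E. norm (char_sum E (?D h)))\<^sup>2"
    by (intro power_mono norm_char_sum_power2_le[OF G]) simp
  also have "\<dots> \<le> (\<Sum>h\<in>E. (norm (char_sum E (?D h)))\<^sup>2) * (\<Sum>h\<in>E. 1\<^sup>2)"
    using Cauchy_Schwarz_ineq_sum[of "\<lambda>h. norm (char_sum E (?D h))" "\<lambda>h. 1" E] by simp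
  also have "\<dots> \<le> (\<Sum>h\<in>E. real (card E) * real (card (rad E h))) * (\<Sum>h\<in>E. 1\<^sup>2)"
    using rad by (intro mult_right_mono sum_mono) auto
  also have "\<dots> = (real (card E))\<^sup>2 * (\<Sum>h\<in>E. real (card (rad E h)))"
    by (simp add: sum_distrib_left[symmetric] power2_eq_square)
  finally show ?thesis .
qed

text \<open>\<open>bias\<close> sums over \<open>points n\<close>, with \<open>undefined\<close>
  beyond \<open>n\<close>; as \<open>f\<close> sees only the first \<open>n\<close> coordinates, the
  sum can be moved to the group \<open>vecs n\<close>.\<close>

lemma bias_eq_char_sum:
  fixes f :: "(nat \<Rightarrow> 'p::prime_card mod_ring) \<Rightarrow> 'p mod_ring"
  assumes "poly_deg_le n d f"
  shows "bias n f = norm (char_sum (vecs n) f) / real (card (vecs n :: (nat \<Rightarrow> 'p mod_ring) set))"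
proof -
  let ?\<omega> = "exp (2 * complex_of_real pi * \<i> / of_nat CARD('p mod_ring))"
  let ?h = "\<lambda>x i. if i < n then x i else (0 :: 'p mod_ring)"
  have "?\<omega> = cis (2 * pi / real CARD('p))"
    by (simp add: cis_conv_exp mult_ac)
  then have pw: "?\<omega> powi to_int_mod_ring t = additive_char t" for t :: "'p mod_ring"
    by (simp add: additive_char_def cis_power_int mult_ac)
  have "(\<Sum>a\<in>points n. ?\<omega> powi to_int_mod_ring (f a)) = (\<Sum>a\<in>points n. additive_char (f (?h a)))"
    unfolding pw by (intro sum.cong refl arg_cong[of _ _ additive_char] poly_deg_le_cong[OF assms]) auto
  also have "\<dots> = char_sum (vecs n) f"
    unfolding char_sum_def by (rule sum.reindex_bij_betw[OF bij_points_vecs])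
  finally have "(\<Sum>a\<in>points n. ?\<omega> powi to_int_mod_ring (f a)) = char_sum (vecs n) f" .
  moreover have "card (points n :: (nat \<Rightarrow> 'p mod_ring) set) = card (vecs n :: (nat \<Rightarrow> 'p mod_ring) set)"
    by (rule bij_betw_same_card[OF bij_points_vecs])
  ultimately show ?thesis
    by (simp add: bias_def norm_divide)
qed

section \<open>The structure theorem\<close>

text \<open>For the least such \<open>k\<close> the power with exponent \<open>k - 1\<close> is at
  most \<open>q\<close>, and \<open>2 \<le> (3 / 2)\<^sup>2\<close>. This keeps the exponent
  \<open>2 ^ k\<close> from \<open>low_rank_structure\<close> quadratic in the rank.\<close>

lemma doubling_steps_bound:
  fixes q :: real
  assumes "q \<ge> 1"
  shows "\<exists>k. q < (3 / 2) ^ k \<and> 2 ^ k \<le> 2 * q\<^sup>2"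
proof -
  define k where "k = (LEAST k. q < (3 / 2 :: real) ^ k)"
  have ex: "\<exists>k. q < (3 / 2 :: real) ^ k" by (rule real_arch_pow) simp
  have k: "q < (3 / 2) ^ k" unfolding k_def by (rule LeastI_ex[OF ex])
  have "k \<noteq> 0" using k assms by (intro notI) simp
  then obtain j where j: "k = Suc j" by (cases k) auto
  have "\<not> q < (3 / 2) ^ j" using not_less_Least[of j "\<lambda>k. q < (3 / 2 :: real) ^ k"] j k_def by simp
  then have "((3 / 2 :: real) ^ j)\<^sup>2 \<le> q\<^sup>2" by (intro power_mono) auto
  moreover have "((3 / 2 :: real) ^ j)\<^sup>2 = ((3 / 2)\<^sup>2) ^ j"
    by (simp only: power_mult[symmetric] mult.commute)
  moreover have "(2 :: real) ^ j \<le> ((3 / 2)\<^sup>2) ^ j" by (intro power_mono) (auto simp: power2_eq_square)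
  ultimately show ?thesis using k by (intro exI[of _ k]) (simp add: j)
qed

text \<open>\<open>t\<close> is the binary logarithm of the rank parameter
  \<open>Q = 2 / \<epsilon>\<close>. The bounds are \<open>log 2 (Q\<^sup>2) = 2 * t\<close> for
  \<open>c\<^sub>1\<close> and \<open>2 ^ k * (1 + t)\<close> with
  \<open>2 ^ k \<le> 2 * t\<^sup>2\<close> for \<open>c\<^sub>2\<close>. The first conjunct serves
  to absorb additive constants later.\<close>

lemma cubic_bias_structure:
  fixes f :: "(nat \<Rightarrow> 'p::prime_card mod_ring) \<Rightarrow> 'p mod_ring"
  assumes f: "poly_deg_le n 3 f" and nz: "\<not> (\<exists>q. poly_deg_le n 2 q \<and> (\<forall>x\<in>vecs n. q x = f x))"
    and pos: "bias n f > 0"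
  defines "t \<equiv> log 2 (2 / bias n f ^ 4)"
  shows "4 * bias n f ^ 4 \<le> 3 \<and> (\<exists>c\<^sub>1 c\<^sub>2 l q r l' g.
    real c\<^sub>1 \<le> 2 * t \<and> real c\<^sub>2 \<le> 4 * t ^ 3 \<and>
    (\<forall>j<c\<^sub>1. linear_form n (l j) \<and> poly_deg_le n 2 (q j)) \<and> poly_deg_le n 2 r \<and>
    (\<forall>j<c\<^sub>2. linear_form n (l' j)) \<and> poly_deg_le c\<^sub>2 3 g \<and>
    (\<forall>x\<in>vecs n. f x = (\<Sum>j<c\<^sub>1. l j x * q j x) + r x + g (\<lambda>j. l' j x)))"
proof -
  let ?E = "vecs n :: (nat \<Rightarrow> 'p mod_ring) set"
  define T where "T = third_difference f"
  interpret symmetric_trilinear ?E T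
    by standard (auto simp: T_def vecs_subgroup finite_vecs third_difference_add1[OF f]
        intro: third_difference_sym12 third_difference_sym23)
  let ?n = "real (card ?E)"
  have n: "?n > 0" using add_subgroup_card_pos[OF G finite_G] by simp
  define \<epsilon> where "\<epsilon> = bias n f ^ 4"
  have \<epsilon>0: "\<epsilon> > 0" using pos by (simp add: \<epsilon>_def)
  have "norm (char_sum ?E f) = bias n f * ?n" using n by (simp add: bias_eq_char_sum[OF f])
  then have "\<epsilon> * ?n ^ 4 = norm (char_sum ?E f) ^ 4" by (simp add: \<epsilon>_def power_mult_distrib)
  also have "\<dots> \<le> ?n\<^sup>2 * (\<Sum>h\<in>?E. real (card (rad ?E h)))"
    unfolding T_def by (rule cubic_bias_le_radicals[OF f])
  finally have "?n\<^sup>2 * (\<epsilon> * ?n\<^sup>2) \<le> ?n\<^sup>2 * (\<Sum>h\<in>?E. real (card (rad ?E h)))"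
    by (simp add: algebra_simps power2_eq_square power4_eq_xxxx)
  then have \<epsilon>: "\<epsilon> * ?n\<^sup>2 \<le> (\<Sum>h\<in>?E. real (card (rad ?E h)))" using n by simp
  \<comment> \<open>If \<open>T\<close> vanished, \<open>f\<close> would be quadratic on the whole
    space.\<close>
  have "\<exists>a\<in>?E. \<exists>b\<in>?E. \<exists>c\<in>?E. T a b c \<noteq> 0"
    using zero_third_difference_quadratic[of n f] nz unfolding T_def by blast
  then have "4 * (\<Sum>h\<in>?E. real (card (rad ?E h))) \<le> 3 * ?n\<^sup>2" using sum_rad_le_three_quarters by blast
  then have "(4 * \<epsilon>) * ?n\<^sup>2 \<le> 3 * ?n\<^sup>2" using \<epsilon> by linarith
  then have \<epsilon>34: "4 * \<epsilon> \<le> 3" using n by simp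

  \<comment> \<open>\<open>Q\<close> acts both as the bound on the index of the radicals and as the
    inverse density of \<open>A\<close>.\<close>
  define Q where "Q = 2 / \<epsilon>"
  have Q: "Q > 2" using \<epsilon>0 \<epsilon>34 by (simp add: Q_def field_simps)
  have t: "t = log 2 Q" by (simp add: t_def Q_def \<epsilon>_def)
  have t1: "t \<ge> 1" using Q by (simp add: t le_log_iff)
  obtain k where k: "t < (3 / 2) ^ k" "2 ^ k \<le> 2 * t\<^sup>2" using doubling_steps_bound[OF t1] by blast
  have Q_powr: "Q = 2 powr t" using Q by (simp add: t)
  define A where "A = {h \<in> ?E. ?n \<le> Q * real (card (rad ?E h))}"
  have "\<exists>K' V. add_subgroup K' \<and> K' \<subseteq> ?E \<and> add_subgroup V \<and> V \<subseteq> ?E \<and>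
     ?n \<le> Q\<^sup>2 * real (card K') \<and> ?n \<le> (2 * Q) ^ (2 ^ k) * real (card V) \<and>
     (\<forall>y\<in>V. \<forall>z\<in>K'. \<forall>w\<in>K'. T y z w = 0)"
  proof (rule low_rank_structure)
    show "?n \<le> Q * real (card A)"
      unfolding A_def Q_def by (rule many_large_radicals[OF \<epsilon> \<epsilon>0])
    show "Q < 2 powr ((3 / 2) ^ k)" using k(1) by (simp add: Q_powr)
  qed (use Q G in \<open>auto simp: A_def\<close>)
  then obtain K V where KV: "add_subgroup K" "K \<subseteq> ?E" "add_subgroup V" "V \<subseteq> ?E"
    "?n \<le> Q\<^sup>2 * real (card K)" "?n \<le> (2 * Q) ^ (2 ^ k) * real (card V)"
    "\<And>x y z. x \<in> V \<Longrightarrow> y \<in> K \<Longrightarrow> z \<in> K \<Longrightarrow> third_difference f x y z = 0"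
    unfolding T_def by blast
  have index: "real c \<le> log 2 R" if "2 ^ c * card H \<le> card ?E" "?n \<le> R * real (card H)" "add_subgroup H"
      "H \<subseteq> ?E" "R > 0" for c H R
  proof -
    have "card H > 0" using add_subgroup_card_pos[OF that(3)] finite_subset[OF that(4) finite_G] by blast
    have "real (2 ^ c * card H) \<le> ?n" using that(1) by (rule of_nat_mono)
    then have "2 ^ c * real (card H) \<le> R * real (card H)" using that(2) by simp
    then have "2 ^ c \<le> R" using \<open>card H > 0\<close> by simp
    then have "2 powr real c \<le> R" by (simp add: powr_realpow)
    then show ?thesis using that(5) by (simp add: le_log_iff)
  qed
  obtain c1 c2 l q r l' g where S:
    "2 ^ c1 * card K \<le> card ?E" "2 ^ c2 * card V \<le> card ?E"
    "\<forall>j<c1. linear_form n (l j) \<and> poly_deg_le n 2 (q j)" "poly_deg_le n 2 r"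
    "\<forall>j<c2. linear_form n (l' j)" "poly_deg_le c2 3 g"
    "\<forall>x\<in>?E. f x = (\<Sum>j<c1. l j x * q j x) + r x + g (\<lambda>j. l' j x)"
    using cubic_structure[OF f KV(1-4,7)] by blast
  have "real c1 \<le> log 2 (Q\<^sup>2)" using index[OF S(1) KV(5,1,2)] Q by simp
  then have c1: "real c1 \<le> 2 * t" using Q by (simp add: t log_nat_power)
  have "real c2 \<le> log 2 ((2 * Q) ^ (2 ^ k))" using index[OF S(2) KV(6,3,4)] Q by simp
  also have "\<dots> = 2 ^ k * (1 + t)" using Q by (simp add: t log_nat_power log_mult distrib_left)
  also have "\<dots> \<le> (2 * t\<^sup>2) * (2 * t)" using k(2) t1 by (intro mult_mono) auto
  finally have "real c2 \<le> 4 * t ^ 3" by (simp add: power2_eq_square power3_eq_cube)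
  then show ?thesis using c1 S(3-7) \<epsilon>34 unfolding \<epsilon>_def by blast
qed

text \<open>The logarithm equals \<open>1 + 4 / ln 2 * ln (1 / \<delta>)\<close>. The hypothesis
  gives \<open>ln (4 / 3) \<le> 4 * ln (1 / \<delta>)\<close>, which absorbs the 1 and explains the
  first summand of \<open>B\<close>.\<close>

lemma log_bias_bound:
  fixes \<delta> :: real
  assumes "0 < \<delta>" "4 * \<delta> ^ 4 \<le> 3"
  defines "B \<equiv> 4 / ln (4 / 3) + 4 / ln 2"
  shows "1 \<le> log 2 (2 / \<delta> ^ 4)" "log 2 (2 / \<delta> ^ 4) \<le> B * ln (1 / \<delta>)"
proof -
  let ?L = "ln (1 / \<delta>)"
  have L: "ln (1 / \<delta> ^ 4) = 4 * ?L" using assms(1) by (simp add: ln_div ln_realpow)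
  have "4 / 3 \<le> 1 / \<delta> ^ 4" using assms by (simp add: field_simps)
  then have "ln (4 / 3) \<le> ln (1 / \<delta> ^ 4)" using assms(1) by (subst ln_le_cancel_iff) auto
  then have "ln (4 / 3) \<le> 4 * ?L" by (simp only: L)
  moreover have pos: "ln (4 / 3 :: real) > 0" by simp
  ultimately have *: "1 \<le> 4 / ln (4 / 3) * ?L" by (simp add: field_simps)
  have eq: "log 2 (2 / \<delta> ^ 4) = 1 + 4 / ln 2 * ?L"
    using assms(1) L by (simp add: log_def ln_div add_divide_distrib diff_divide_distrib)
  show "log 2 (2 / \<delta> ^ 4) \<le> B * ?L" using * unfolding eq B_def by (simp add: distrib_right)
  have "0 \<le> ?L" using \<open>ln (4 / 3) \<le> 4 * ?L\<close> pos by linarith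
  then show "1 \<le> log 2 (2 / \<delta> ^ 4)" unfolding eq by simp
qed

lemma poly_fun_family:
  assumes "\<And>j. j < c \<Longrightarrow> poly_deg_le n d (p j)"
  obtains P where "\<And>j. j < c \<Longrightarrow> P j \<in> polys_in n" "\<And>j. j < c \<Longrightarrow> poly_fun (P j) = p j"
    "\<And>j. j < c \<Longrightarrow> fun_degree n (poly_fun (P j)) \<le> d"
proof -
  have "\<forall>j. \<exists>P. j < c \<longrightarrow> P \<in> polys_in n \<and> poly_fun P = p j"
    using poly_deg_le_imp_poly_fun[OF assms] by blast
  from choice[OF this] obtain P where P: "\<And>j. j < c \<Longrightarrow> P j \<in> polys_in n \<and> poly_fun (P j) = p j" by blast
  then show ?thesis using that[of P] assms fun_degree_le[of n d] by metis
qed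

theorem theorem1:
  shows "\<exists>C\<^sub>1 C\<^sub>2 :: real. \<forall>(n::nat) (f :: 'p::prime_card mod_ring mpolynomial) (\<delta>::real).
    f \<in> polys_in n \<longrightarrow> fun_degree n (poly_fun f) = 3 \<longrightarrow> bias n (poly_fun f) = \<delta> \<longrightarrow>
    (\<exists>(c\<^sub>1::nat) (c\<^sub>2::nat)
       (q :: nat \<Rightarrow> 'p mod_ring mpolynomial)
       (l :: nat \<Rightarrow> 'p mod_ring mpolynomial)
       (l' :: nat \<Rightarrow> 'p mod_ring mpolynomial)
       (g :: 'p mod_ring mpolynomial).
       (0 < \<delta> \<longrightarrow> real c\<^sub>1 \<le> C\<^sub>1 * ln (1 / \<delta>) \<and> real c\<^sub>2 \<le> C\<^sub>2 * ln (1 / \<delta>) ^ 4) \<and>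
       (\<forall>j<c\<^sub>1. q j \<in> polys_in n \<and> fun_degree n (poly_fun (q j)) \<le> 2) \<and>
       (\<forall>j<c\<^sub>1. l j \<in> polys_in n \<and> fun_degree n (poly_fun (l j)) \<le> 1) \<and>
       (\<forall>j<c\<^sub>2. l' j \<in> polys_in n \<and> fun_degree n (poly_fun (l' j)) \<le> 1) \<and>
       g \<in> polys_in c\<^sub>2 \<and> fun_degree c\<^sub>2 (poly_fun g) \<le> 3 \<and>
       (\<forall>a\<in>points n.
          poly_fun f a = (\<Sum>j<c\<^sub>1. poly_fun (l j) a * poly_fun (q j) a)
                         + poly_fun g (\<lambda>j\<in>{..<c\<^sub>2}. poly_fun (l' j) a)))"
proof -
  define B :: real where "B = 4 / ln (4 / 3) + 4 / ln 2"
  show ?thesis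
  \<comment> \<open>One product more than the \<open>2 * t\<close> available is needed, and
    \<open>2 * t + 1 \<le> 3 * t\<close>. For the other constant,
    \<open>4 * t ^ 3 \<le> 4 * t ^ 4\<close>. Both use \<open>t \<ge> 1\<close>.\<close>
  proof (rule exI[of _ "3 * B"], rule exI[of _ "4 * B ^ 4"], intro allI impI)
    fix n :: nat and f :: "'p mod_ring mpolynomial" and \<delta> :: real
    assume f: "f \<in> polys_in n" and deg: "fun_degree n (poly_fun f) = 3" and \<delta>: "bias n (poly_fun f) = \<delta>"
    have f3: "poly_deg_le n 3 (poly_fun f)" using poly_deg_le_fun_degree[OF f] deg by simp
    have trunc: "\<exists>x\<in>vecs n. \<forall>i<n. x i = a i" for a :: "nat \<Rightarrow> 'p mod_ring"
      by (rule bexI[of _ "\<lambda>i. if i < n then a i else 0"]) (auto simp: vecs_def)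
    have nz: "\<not> (\<exists>q. poly_deg_le n 2 q \<and> (\<forall>x\<in>vecs n. q x = poly_fun f x))"
    proof
      assume "\<exists>q. poly_deg_le n 2 q \<and> (\<forall>x\<in>vecs n. q x = poly_fun f x)"
      then obtain q where q: "poly_deg_le n 2 q" "\<And>x. x \<in> vecs n \<Longrightarrow> q x = poly_fun f x" by blast
      have "q a = poly_fun f a" for a
      proof -
        obtain x where "x \<in> vecs n" "\<And>i. i < n \<Longrightarrow> x i = a i" using trunc by blast
        then show ?thesis using poly_deg_le_cong[OF q(1)] poly_fun_cong[OF f] q(2) by metis
      qed
      then have "fun_degree n (poly_fun f) \<le> 2" by (intro fun_degree_le[OF q(1)])
      then show False using deg by simp
    qed
    show "\<exists>(c\<^sub>1::nat) (c\<^sub>2::nat)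
       (q :: nat \<Rightarrow> 'p mod_ring mpolynomial)
       (l :: nat \<Rightarrow> 'p mod_ring mpolynomial)
       (l' :: nat \<Rightarrow> 'p mod_ring mpolynomial)
       (g :: 'p mod_ring mpolynomial).
       (0 < \<delta> \<longrightarrow> real c\<^sub>1 \<le> 3 * B * ln (1 / \<delta>) \<and> real c\<^sub>2 \<le> 4 * B ^ 4 * ln (1 / \<delta>) ^ 4) \<and>
       (\<forall>j<c\<^sub>1. q j \<in> polys_in n \<and> fun_degree n (poly_fun (q j)) \<le> 2) \<and>
       (\<forall>j<c\<^sub>1. l j \<in> polys_in n \<and> fun_degree n (poly_fun (l j)) \<le> 1) \<and>
       (\<forall>j<c\<^sub>2. l' j \<in> polys_in n \<and> fun_degree n (poly_fun (l' j)) \<le> 1) \<and>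
       g \<in> polys_in c\<^sub>2 \<and> fun_degree c\<^sub>2 (poly_fun g) \<le> 3 \<and>
       (\<forall>a\<in>points n.
          poly_fun f a = (\<Sum>j<c\<^sub>1. poly_fun (l j) a * poly_fun (q j) a)
                         + poly_fun g (\<lambda>j\<in>{..<c\<^sub>2}. poly_fun (l' j) a))"
    proof (cases "\<delta> > 0")
      \<comment> \<open>The sizes are then unrestricted: \<open>f\<close> itself serves as
        \<open>g\<close>, with the \<open>n\<close> variables as linear functions and no
        products.\<close>
      case False
      obtain X where X: "\<And>j. j < n \<Longrightarrow> X j \<in> polys_in n"
        "\<And>j. j < n \<Longrightarrow> poly_fun (X j) = (\<lambda>x. x j :: 'p mod_ring)"
        "\<And>j. j < n \<Longrightarrow> fun_degree n (poly_fun (X j)) \<le> 1"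
        using poly_fun_family[of n n 1 "\<lambda>j x. x j"] poly_deg_le_var by metis
      have "poly_fun f a = poly_fun f (\<lambda>j\<in>{..<n}. poly_fun (X j) a)" for a
        using X(2) by (intro poly_fun_cong[OF f]) simp
      then show ?thesis
        using False X f deg by (intro exI[of _ 0] exI[of _ n] exI[of _ X] exI[of _ f]) auto
    next
      case True
      define t where "t = log 2 (2 / \<delta> ^ 4)"
      note str = cubic_bias_structure[OF f3 nz, unfolded \<delta>, OF True, folded t_def]
      obtain c1 c2 l q r l' g where c: "real c1 \<le> 2 * t" "real c2 \<le> 4 * t ^ 3"
        and lq: "\<And>j. j < c1 \<Longrightarrow> linear_form n (l j)" "\<And>j. j < c1 \<Longrightarrow> poly_deg_le n 2 (q j)"
        and r: "poly_deg_le n 2 r"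
        and l': "\<And>j. j < c2 \<Longrightarrow> linear_form n (l' j)" and g: "poly_deg_le c2 3 g"
        and eq: "\<And>x. x \<in> vecs n \<Longrightarrow>
          poly_fun f x = (\<Sum>j<c1. l j x * q j x) + r x + g (\<lambda>j. l' j x)"
        using str by blast
      have t: "1 \<le> t" "t \<le> B * ln (1 / \<delta>)"
        using log_bias_bound[OF True] str unfolding t_def B_def by blast+
      \<comment> \<open>The quadratic remainder \<open>r\<close> becomes the product of
        \<open>r\<close> with the constant linear function 1, at index \<open>c1\<close>.\<close>
      define l2 where "l2 j = (if j < c1 then l j else (\<lambda>x. 1))" for j
      define q2 where "q2 j = (if j < c1 then q j else r)" for j
      have l2: "poly_deg_le n 1 (l2 j)" for j
        using lq(1) poly_deg_le_linear_form poly_deg_le.const by (auto simp: l2_def)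
      have q2: "poly_deg_le n 2 (q2 j)" for j using lq(2) r by (auto simp: q2_def)
      have l'1: "poly_deg_le n 1 (l' j)" if "j < c2" for j using poly_deg_le_linear_form[OF l'[OF that]] .
      obtain PL where PL: "\<And>j. j < Suc c1 \<Longrightarrow> PL j \<in> polys_in n" "\<And>j. j < Suc c1 \<Longrightarrow> poly_fun (PL j) = l2 j"
        "\<And>j. j < Suc c1 \<Longrightarrow> fun_degree n (poly_fun (PL j)) \<le> 1"
        using poly_fun_family[of "Suc c1" n 1 l2] l2 by blast
      obtain PQ where PQ: "\<And>j. j < Suc c1 \<Longrightarrow> PQ j \<in> polys_in n" "\<And>j. j < Suc c1 \<Longrightarrow> poly_fun (PQ j) = q2 j"
        "\<And>j. j < Suc c1 \<Longrightarrow> fun_degree n (poly_fun (PQ j)) \<le> 2"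
        using poly_fun_family[of "Suc c1" n 2 q2] q2 by blast
      obtain PL' where PL': "\<And>j. j < c2 \<Longrightarrow> PL' j \<in> polys_in n" "\<And>j. j < c2 \<Longrightarrow> poly_fun (PL' j) = l' j"
        "\<And>j. j < c2 \<Longrightarrow> fun_degree n (poly_fun (PL' j)) \<le> 1"
        using poly_fun_family[of c2 n 1 l'] l'1 by blast
      obtain Pg where Pg: "Pg \<in> polys_in c2" "poly_fun Pg = g"
        using poly_deg_le_imp_poly_fun[OF g] by blast
      have Pg_deg: "fun_degree c2 (poly_fun Pg) \<le> 3" unfolding Pg(2) by (rule fun_degree_le[OF g]) simp
      have "poly_fun f a = (\<Sum>j<Suc c1. poly_fun (PL j) a * poly_fun (PQ j) a)
                         + poly_fun Pg (\<lambda>j\<in>{..<c2}. poly_fun (PL' j) a)" for a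
      proof -
        \<comment> \<open>The decomposition is available on \<open>vecs n\<close>; all functions
          involved see only the first \<open>n\<close> coordinates, so it transfers to
          \<open>a\<close>.\<close>
        obtain x where x: "x \<in> vecs n" "\<And>i. i < n \<Longrightarrow> x i = a i" using trunc by blast
        have "poly_fun f a = poly_fun f x" using poly_fun_cong[OF f, of a x] x(2) by simp
        also have "\<dots> = (\<Sum>j<Suc c1. l2 j x * q2 j x) + g (\<lambda>j. l' j x)"
          unfolding eq[OF x(1)] by (simp add: l2_def q2_def)
        also have "(\<Sum>j<Suc c1. l2 j x * q2 j x) = (\<Sum>j<Suc c1. poly_fun (PL j) a * poly_fun (PQ j) a)"
          using PL(2) PQ(2) x(2)
          by (intro sum.cong refl arg_cong2[of _ _ _ _ "(*)"]) (auto intro: poly_deg_le_cong[OF l2] poly_deg_le_cong[OF q2])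
        also have "g (\<lambda>j. l' j x) = poly_fun Pg (\<lambda>j\<in>{..<c2}. poly_fun (PL' j) a)"
          unfolding Pg(2) using PL'(2) x(2)
          by (intro poly_deg_le_cong[OF g]) (auto intro: poly_deg_le_cong[OF l'1])
        finally show ?thesis .
      qed
      then have eq': "\<forall>a\<in>points n. poly_fun f a = (\<Sum>j<Suc c1. poly_fun (PL j) a * poly_fun (PQ j) a)
                         + poly_fun Pg (\<lambda>j\<in>{..<c2}. poly_fun (PL' j) a)" by blast
      have "t ^ 3 \<le> t ^ 4" using t(1) by (intro power_increasing) auto
      also have "\<dots> \<le> (B * ln (1 / \<delta>)) ^ 4" using t by (intro power_mono) auto
      finally have bounds: "0 < \<delta> \<longrightarrow> real (Suc c1) \<le> 3 * B * ln (1 / \<delta>) \<and> real c2 \<le> 4 * B ^ 4 * ln (1 / \<delta>) ^ 4"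
        using c t by (simp add: power_mult_distrib)
      have "\<forall>j<Suc c1. PQ j \<in> polys_in n \<and> fun_degree n (poly_fun (PQ j)) \<le> 2"
        "\<forall>j<Suc c1. PL j \<in> polys_in n \<and> fun_degree n (poly_fun (PL j)) \<le> 1"
        "\<forall>j<c2. PL' j \<in> polys_in n \<and> fun_degree n (poly_fun (PL' j)) \<le> 1"
        using PL PQ PL' by blast+
      note props = bounds this Pg(1) Pg_deg eq'
      show ?thesis
        by (rule exI[of _ "Suc c1"], rule exI[of _ c2], rule exI[of _ PQ], rule exI[of _ PL],
            rule exI[of _ PL'], rule exI[of _ Pg]) (intro conjI props)
    qed
  qed
qed

end
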